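(* Let $K,L\subset\mathbb{R}^2$ be convex bodies that are at a dilation position, and let $r=r(K,L)$ and $R=R(K,L)$ be the relative inradius and relative outradius of $K$ with respect to $L$. Then for every $p\in[-\infty,0]$ and every $\mu>0$, $$\left|\tfrac12\cdot K+_p\tfrac12\cdot L\right|\;\geq\;\min_{t\in\{r,R\}}\left\{\left(\frac{1+t^p}{2}\right)^{2/p}\frac{|K|/t+\mu|L|}{t+\mu}\right\}.\qquad( * )$$ Equality holds in $( * )$ if $K$ and $L$ are dilates; when $\mu=1$ and $|K|=|L|$, equality holds in $( * )$ if $K$ and $L$ are dilates or parallelograms with parallel sides (i.e. the sides of $K$ are parallel to the sides of $L$). In particular: (i) when $p=0$, taking $\mu=\sqrt{|K|/|L|}$ in $( * )$ yields $$\left|\tfrac12\cdot K+_0\tfrac12\cdot L\right|\geq |K|^{1/2}\,|L|^{1/2};$$ (ii) when $p=-\infty$ and $r<1<R$, taking $\mu=\dfrac{r(R-1)}{1-r}$ in $( * )$ yields $$|K\cap L|\geq\min\left\{\frac{|K|}{R},\,r|L|\right\}.$$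
   Context: A convex body is a compact convex set with nonempty interior; $|\cdot|$ denotes volume (area in $\mathbb{R}^2$), $o$ is the origin, and $h_K(v)=\max\{x\cdot v:x\in K\}$ is the support function of $K$. The relative inradius and relative outradius of $K$ with respect to $L$ are $$r(K,L)=\max\{t>0:x+tL\subset K\text{ for some }x\in\mathbb{R}^n\},\qquad R(K,L)=\min\{t>0:K\subset x+tL\text{ for some }x\in\mathbb{R}^n\}.$$ Writing $r=r(K,L)$, $R=R(K,L)$, the convex bodies $K$ and $L$ are said to be at a dilation position if $$o\in K\cap L\quad\text{and}\quad rL\subset K\subset RL .$$ $L_p$-mean: for $p\in(-\infty,0)$ and $K,L$ at a dilation position, $$\tfrac12\cdot K+_p\tfrac12\cdot L=\left\{x\in\mathbb{R}^n:x\cdot v\leq\left(\frac{h_K(v)^p+h_L(v)^p}{2}\right)^{1/p}\ \ \forall v\in S^{n-1}\right\},$$ where the right-hand bound is understood by continuity as $0$ at directions $v$ with $h_K(v)=h_L(v)=0$ (by $rL\subset K\subset RL$, $h_K(v)=0$ if and only if $h_L(v)=0$). For $p=0$, $$\tfrac12\cdot K+_0\tfrac12\cdot L=\left\{x\in\mathbb{R}^n:x\cdot v\leq h_K(v)^{1/2}h_L(v)^{1/2}\ \ \forall v\in S^{n-1}\right\},$$ and for $p=-\infty$, $$\tfrac12\cdot K+_{-\infty}\tfrac12\cdot L=K\cap L .$$ Here $n=2$. Convention for the scalar factor: for $t>0$, the expression $\left(\frac{1+t^p}{2}\right)^{2/p}$ is understood as $t$ when $p=0$ and as $\min\{t,1\}^2$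 when $p=-\infty$. *)

theory Defs
  imports "HOL-Analysis.Analysis"
begin

definition convex_body :: "'a::euclidean_space set \<Rightarrow> bool" where
  "convex_body K \<longleftrightarrow> compact K \<and> convex K \<and> interior K \<noteq> {}"

abbreviation vol :: "'a::euclidean_space set \<Rightarrow> real" where
  "vol \<equiv> measure lebesgue"

text \<open>
  The suprema and infima below are attained when the sets are convex bodies; see
  the lemmas \<open>support_fun_max\<close>, \<open>rel_inradius_max\<close> and \<open>rel_outradius_min\<close>.
\<close>

definition support_fun :: "'a::euclidean_space set \<Rightarrow> 'a \<Rightarrow> real" where
  "support_fun K v = (SUP x\<in>K. x \<bullet> v)"

abbreviation homothet :: "'a::real_vector \<Rightarrow> real \<Rightarrow> 'a set \<Rightarrow> 'a set" where
  "homothet x t L \<equiv> (\<lambda>y. x + t *\<^sub>R y) ` L"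

definition rel_inradius :: "'a::euclidean_space set \<Rightarrow> 'a set \<Rightarrow> real" where
  "rel_inradius K L = Sup {t. 0 < t \<and> (\<exists>x. homothet x t L \<subseteq> K)}"

definition rel_outradius :: "'a::euclidean_space set \<Rightarrow> 'a set \<Rightarrow> real" where
  "rel_outradius K L = Inf {t. 0 < t \<and> (\<exists>x. K \<subseteq> homothet x t L)}"

definition dilation_position :: "'a::euclidean_space set \<Rightarrow> 'a set \<Rightarrow> bool" where
  "dilation_position K L \<longleftrightarrow>
     0 \<in> K \<inter> L \<and>
     (\<lambda>y. rel_inradius K L *\<^sub>R y) ` L \<subseteq> K \<and>
     K \<subseteq> (\<lambda>y. rel_outradius K L *\<^sub>R y) ` L"

text \<open>
  Only exponents in \<open>[-\<infinity>, 0]\<close> are of interest in the following definitions.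
  The value at \<open>a = b = 0\<close> is the limit for negative \<open>p\<close>; by the dilation position,
  \<open>a\<close> and \<open>b\<close> never vanish separately where the mean is used.
\<close>

definition half_power_mean :: "real \<Rightarrow> real \<Rightarrow> real \<Rightarrow> real" where
  "half_power_mean p a b =
     (if a = 0 \<and> b = 0 then 0 else ((a powr p + b powr p) / 2) powr (1 / p))"

definition Lp_mean :: "ereal \<Rightarrow> 'a::euclidean_space set \<Rightarrow> 'a set \<Rightarrow> 'a set" where
  "Lp_mean p K L =
     (if p = -\<infinity> then K \<inter> L
      else if p = 0 then
        {x. \<forall>v\<in>sphere 0 1. x \<bullet> v \<le> sqrt (support_fun K v) * sqrt (support_fun L v)}
      else
        {x. \<forall>v\<in>sphere 0 1.
              x \<bullet> v \<le> half_power_mean (real_of_ereal p) (support_fun K v) (support_fun L v)})"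

text \<open>The expression \<open>((1 + t\<^sup>p) / 2)\<^bsup>2/p\<^esup>\<close> with its conventions at \<open>p = 0\<close> and \<open>p = -\<infinity>\<close>.\<close>

definition scalar_factor :: "ereal \<Rightarrow> real \<Rightarrow> real" where
  "scalar_factor p t =
     (if p = -\<infinity> then (min t 1)\<^sup>2
      else if p = 0 then t
      else ((1 + t powr real_of_ereal p) / 2) powr (2 / real_of_ereal p))"

definition planar_lower_bound :: "ereal \<Rightarrow> real \<Rightarrow> (real^2) set \<Rightarrow> (real^2) set \<Rightarrow> real" where
  "planar_lower_bound p \<mu> K L =
     Min ((\<lambda>t. scalar_factor p t * ((vol K / t + \<mu> * vol L) / (t + \<mu>)))
            ` {rel_inradius K L, rel_outradius K L})"

definition dilates :: "'a::real_vector set \<Rightarrow> 'a set \<Rightarrow> bool" where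
  "dilates K L \<longleftrightarrow> (\<exists>c>0. K = (\<lambda>y. c *\<^sub>R y) ` L)"

text \<open>\<open>u\<close> and \<open>w\<close> are the edge vectors of the parallelogram \<open>P\<close>.\<close>

definition parallelogram_with_sides :: "'a::real_vector set \<Rightarrow> 'a \<Rightarrow> 'a \<Rightarrow> bool" where
  "parallelogram_with_sides P u w \<longleftrightarrow>
     u \<noteq> w \<and> independent {u, w} \<and>
     (\<exists>x. P = {x + s *\<^sub>R u + t *\<^sub>R w | s t. s \<in> {0..1} \<and> t \<in> {0..1}})"

definition parallel_parallelograms :: "'a::real_vector set \<Rightarrow> 'a set \<Rightarrow> bool" where
  "parallel_parallelograms K L \<longleftrightarrow>
     (\<exists>u w u' w'. parallelogram_with_sides K u w \<and> parallelogram_with_sides L u' w' \<and>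
        u' \<in> span {u} \<and> w' \<in> span {w})"

lemma support_fun_max:
  assumes "convex_body K"
  shows "support_fun K v \<in> (\<lambda>x. x \<bullet> v) ` K" and "\<forall>x\<in>K. x \<bullet> v \<le> support_fun K v"
proof -
  have c: "compact ((\<lambda>x. x \<bullet> v) ` K)" and n: "(\<lambda>x. x \<bullet> v) ` K \<noteq> {}"
    using assms interior_subset[of K] unfolding convex_body_def
    by (auto intro!: compact_continuous_image continuous_intros)
  have "bdd_above ((\<lambda>x. x \<bullet> v) ` K)"
    by (rule bounded_imp_bdd_above[OF compact_imp_bounded[OF c]])
  then show "support_fun K v \<in> (\<lambda>x. x \<bullet> v) ` K" "\<forall>x\<in>K. x \<bullet> v \<le> support_fun K v"
    unfolding support_fun_def
    using closed_contains_Sup[OF n _ compact_imp_closed[OF c]] by (auto intro: cSUP_upper)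
qed

lemma rel_inradius_max:
  assumes K: "convex_body K" and L: "convex_body L"
  shows "rel_inradius K L \<in> {t. 0 < t \<and> (\<exists>x. homothet x t L \<subseteq> K)}"
    and "\<forall>t\<in>{t. 0 < t \<and> (\<exists>x. homothet x t L \<subseteq> K)}. t \<le> rel_inradius K L"
proof -
  let ?S = "{t. 0 < t \<and> (\<exists>x. homothet x t L \<subseteq> K)}"
  let ?T = "{z. 0 \<le> fst z} \<inter> (\<Inter>y\<in>L. {z. snd z + fst z *\<^sub>R y \<in> K})"
  obtain B where B: "B > 0" "\<And>x. x \<in> K \<Longrightarrow> norm x \<le> B"
    using compact_imp_bounded[of K] K unfolding convex_body_def bounded_pos by auto
  obtain C where C: "C > 0" "\<And>x. x \<in> L \<Longrightarrow> norm x \<le> C"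
    using compact_imp_bounded[of L] L unfolding convex_body_def bounded_pos by auto
  obtain a e where e: "e > 0" "cball a e \<subseteq> K"
    using K unfolding convex_body_def ex_in_conv[symmetric] mem_interior_cball by auto
  obtain b d where d: "d > 0" "cball b d \<subseteq> L"
    using L unfolding convex_body_def ex_in_conv[symmetric] mem_interior_cball by auto
  obtain i :: 'a where i: "i \<in> Basis" using nonempty_Basis by blast
  define b' where "b' = b + d *\<^sub>R i"
  have nb: "norm (b' - b) = d" using d(1) i by (simp add: b'_def)
  have "b \<in> cball b d" "b' \<in> cball b d"
    using d(1) nb by (simp_all add: dist_norm norm_minus_commute)
  then have bL: "b \<in> L" "b' \<in> L" using d(2) by blast+
  have "closed {z::real \<times> 'a. snd z + fst z *\<^sub>R y \<in> K}" for y
  proof -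
    have "closed K" using K compact_imp_closed unfolding convex_body_def by auto
    moreover have "continuous_on UNIV (\<lambda>z::real \<times> 'a. snd z + fst z *\<^sub>R y)"
      by (intro continuous_intros)
    ultimately have "closed ((\<lambda>z::real \<times> 'a. snd z + fst z *\<^sub>R y) -` K)"
      by (rule closed_vimage)
    then show ?thesis by (simp add: vimage_def)
  qed
  then have cl: "closed ?T"
    by (intro closed_Int closed_INT ballI closed_Collect_le continuous_on_const
        continuous_on_fst continuous_on_id) auto
  have tb: "fst z \<le> 2 * B / d \<and> norm (snd z) \<le> B + 2 * B / d * C" if z: "z \<in> ?T" for z
  proof -
    have 1: "norm (snd z + fst z *\<^sub>R b) \<le> B" "norm (snd z + fst z *\<^sub>R b') \<le> B"
      using z bL B by auto
    have "fst z * d = norm (fst z *\<^sub>R (b' - b))" using z nb by simp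
    also have "\<dots> = norm ((snd z + fst z *\<^sub>R b') - (snd z + fst z *\<^sub>R b))"
      by (simp add: algebra_simps)
    also have "\<dots> \<le> norm (snd z + fst z *\<^sub>R b') + norm (snd z + fst z *\<^sub>R b)"
      by (rule norm_triangle_ineq4)
    also have "\<dots> \<le> 2 * B" using 1 by linarith
    finally have 2: "fst z \<le> 2 * B / d" using d by (simp add: field_simps)
    have "norm (snd z) \<le> norm (snd z + fst z *\<^sub>R b) + norm (fst z *\<^sub>R b)"
      using norm_triangle_ineq4[of "snd z + fst z *\<^sub>R b" "fst z *\<^sub>R b"] by simp
    moreover have "norm (fst z *\<^sub>R b) \<le> 2 * B / d * C"
    proof -
      have "fst z * norm b \<le> 2 * B / d * C"
        using 2 C(2)[OF bL(1)] B(1) d(1) by (intro mult_mono) auto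
      then show ?thesis using z by simp
    qed
    ultimately show ?thesis using 1 2 by linarith
  qed
  have "?T \<subseteq> {0..2 * B / d} \<times> cball 0 (B + 2 * B / d * C)"
  proof
    fix z assume z: "z \<in> ?T"
    then have "0 \<le> fst z" by blast
    with tb[OF z] show "z \<in> {0..2 * B / d} \<times> cball 0 (B + 2 * B / d * C)"
      by (simp add: mem_Times_iff)
  qed
  then have "bounded ?T"
    by (rule bounded_subset[OF bounded_Times[OF bounded_closed_interval bounded_cball]])
  then have cT: "compact (fst ` ?T)"
    using cl by (intro compact_continuous_image continuous_on_fst continuous_on_id)
      (simp add: compact_eq_bounded_closed)
  have S: "?S = {t \<in> fst ` ?T. 0 < t}"
  proof (intro set_eqI iffI)
    fix t assume "t \<in> ?S"
    then obtain x where "0 < t" "homothet x t L \<subseteq> K" by blast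
    then have "(t, x) \<in> ?T" by auto
    then have "t \<in> fst ` ?T" by (rule image_eqI[rotated]) simp
    with \<open>0 < t\<close> show "t \<in> {t \<in> fst ` ?T. 0 < t}" by simp
  next
    fix t assume "t \<in> {t \<in> fst ` ?T. 0 < t}"
    then obtain x where "(t, x) \<in> ?T" "0 < t" by auto
    then show "t \<in> ?S" by auto
  qed
  have "homothet a (e / C) L \<subseteq> K"
  proof
    fix z assume "z \<in> homothet a (e / C) L"
    then obtain y where y: "y \<in> L" "z = a + (e / C) *\<^sub>R y" by blast
    have "norm ((e / C) *\<^sub>R y) \<le> e" using C(1) C(2)[OF y(1)] e(1) by (simp add: field_simps)
    then show "z \<in> K" using e(2) y(2) by (auto simp: dist_norm)
  qed
  then have pos: "e / C \<in> ?S" "e / C > 0" using e C by auto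
  obtain m where m: "m \<in> fst ` ?T" "\<And>t. t \<in> fst ` ?T \<Longrightarrow> t \<le> m"
  proof -
    have "fst ` ?T \<noteq> {}" using pos(1) unfolding S by blast
    from compact_attains_sup[OF cT this] show ?thesis using that by auto
  qed
  have ub: "t \<le> m" if "t \<in> ?S" for t using that unfolding S by (intro m(2)) simp
  have "0 < m" using ub[OF pos(1)] pos(2) by linarith
  then have mS: "m \<in> ?S" using m(1) unfolding S by simp
  have "rel_inradius K L = m"
    unfolding rel_inradius_def by (rule cSup_eq_maximum[OF mS ub])
  then show "rel_inradius K L \<in> ?S" "\<forall>t\<in>?S. t \<le> rel_inradius K L"
    using mS ub by auto
qed

lemma rel_outradius_min:
  assumes K: "convex_body K" and L: "convex_body L"
  shows "rel_outradius K L \<in> {t. 0 < t \<and> (\<exists>x. K \<subseteq> homothet x t L)}"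
    and "\<forall>t\<in>{t. 0 < t \<and> (\<exists>x. K \<subseteq> homothet x t L)}. rel_outradius K L \<le> t"
proof -
  let ?S = "{t. 0 < t \<and> (\<exists>x. homothet x t K \<subseteq> L)}"
  let ?Q = "{t. 0 < t \<and> (\<exists>x. K \<subseteq> homothet x t L)}"
  have Q: "t \<in> ?Q \<longleftrightarrow> 1 / t \<in> ?S" if t: "0 < t" for t
  proof
    assume "t \<in> ?Q"
    then obtain x where x: "K \<subseteq> homothet x t L" by blast
    have "homothet (- (1 / t) *\<^sub>R x) (1 / t) K \<subseteq> L"
    proof
      fix z assume "z \<in> homothet (- (1 / t) *\<^sub>R x) (1 / t) K"
      then obtain y where y: "y \<in> L" "z = - (1 / t) *\<^sub>R x + (1 / t) *\<^sub>R (x + t *\<^sub>R y)"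
        using x by blast
      then have "z = y" using t by (simp add: scaleR_add_right)
      then show "z \<in> L" using y by simp
    qed
    then have "\<exists>x. homothet x (1 / t) K \<subseteq> L" by (rule exI)
    then show "1 / t \<in> ?S" using t by simp
  next
    assume "1 / t \<in> ?S"
    then obtain x where x: "homothet x (1 / t) K \<subseteq> L" by blast
    have "K \<subseteq> homothet (- t *\<^sub>R x) t L"
    proof
      fix k assume "k \<in> K"
      then have "x + (1 / t) *\<^sub>R k \<in> L" using x by blast
      moreover have "k = - t *\<^sub>R x + t *\<^sub>R (x + (1 / t) *\<^sub>R k)"
        using t by (simp add: scaleR_add_right)
      ultimately show "k \<in> homothet (- t *\<^sub>R x) t L" by blast
    qed
    then show "t \<in> ?Q" using t by blast
  qed
  note m = rel_inradius_max[OF L K]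
  have mp: "0 < rel_inradius L K" using m(1) by blast
  have 1: "1 / rel_inradius L K \<in> ?Q" using Q[of "1 / rel_inradius L K"] m(1) mp by simp
  have 2: "1 / rel_inradius L K \<le> t" if "t \<in> ?Q" for t
  proof -
    have t: "0 < t" using that by blast
    then have "1 / t \<le> rel_inradius L K" using Q that m(2) by blast
    then show ?thesis using t mp by (simp add: field_simps)
  qed
  have "rel_outradius K L = 1 / rel_inradius L K"
    unfolding rel_outradius_def by (rule cInf_eq_minimum[OF 1 2])
  then show "rel_outradius K L \<in> ?Q" "\<forall>t\<in>?Q. rel_outradius K L \<le> t"
    using 1 2 by auto
qed

end

theory Submission
  imports Defs
begin

text \<open>
  Write \<open>h\<^sub>K\<close>, \<open>h\<^sub>L\<close> for the support functions and \<open>m(t)\<close> for the \<open>p\<close>-mean of \<open>t\<close> and \<open>1\<close>.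
  Since \<open>r L \<subseteq> K \<subseteq> R L\<close>, the ratio \<open>h\<^sub>K / h\<^sub>L\<close> takes values in \<open>[r, R]\<close>. On this interval
  the concave function \<open>m\<close> lies above its chord \<open>\<alpha> t + \<beta>\<close>, and \<open>\<alpha>, \<beta> \<ge> 0\<close> because \<open>m(t)\<close>
  is increasing and \<open>m(t) / t\<close> is decreasing (\<open>lp_mean_chord\<close>). Hence the mean body \<open>Q\<close>
  contains the Minkowski combination \<open>\<alpha> K + \<beta> L\<close>, and it suffices to bound the area of the
  latter from below.

  That bound is a sharpened planar Brunn-Minkowski inequality of Bonnesen type
  (\<open>area_comb_maximal_homothet\<close>): if \<open>L \<subseteq> K\<close> and no homothetic copy of \<open>L\<close> with ratio greater
  than 1 fits into \<open>K\<close>, then \<open>|a K + b L| \<ge> a |K| + b |L|\<close> for \<open>a, b \<ge> 0\<close> with \<open>a + b = 1\<close>.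
  Applied to \<open>K\<close> and \<open>r L\<close>, and to \<open>L\<close> and \<open>K / R\<close>, it gives
  \<open>|Q| \<ge> m(t) (\<alpha> |K| / t + \<beta> |L|)\<close> for both \<open>t = r\<close> and \<open>t = R\<close>. If \<open>\<alpha> > 0\<close> and \<open>\<mu> = \<beta> / \<alpha>\<close>, these are the
  two terms of the claimed minimum; since the term for \<open>r\<close> decreases in \<open>\<mu>\<close> and the term for \<open>R\<close>
  increases, one of them stays below \<open>|Q|\<close> for every \<open>\<mu>\<close>.

  For the Bonnesen type inequality, maximality of \<open>L\<close> yields common boundary points of \<open>K\<close> and
  \<open>L\<close> whose common outer normals have the origin in their convex hull
  (\<open>contact_directions\<close>); by Caratheodory's theorem two opposite normals or three normals
  suffice. If \<open>K\<close> and \<open>L\<close> have the same projection onto some line, the inequality follows by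
  integrating the one-dimensional Brunn-Minkowski inequality over the fibres
  (\<open>area_comb_equal_projection\<close>). This settles the case of two opposite normals. In the case of
  three contact points the bodies are cut along two chords joining contact points; in each of
  the three pieces the parts of \<open>K\<close> and \<open>L\<close> have a common projection, and the inequality is additive
  under cutting (\<open>area_comb_cut\<close>).

  In the equality cases, dilates satisfy \<open>r = R\<close>, and then \<open>Q = m(r) L\<close>. Parallelograms
  with parallel sides are linear images of boxes; \<open>Q\<close> is contained in the parallelogram
  cut out by the four edge normals, and if \<open>|K| = |L|\<close>, the area of this parallelogram is exactly
  the lower bound for \<open>\<mu> = 1\<close>.
\<close>

section \<open>Minkowski combinations and areas by slices\<close>

text \<open>The Minkowski combination \<open>a K + b L\<close>.\<close>

definition minkowski_comb :: "real \<Rightarrow> real \<Rightarrow> 'a::real_vector set \<Rightarrow> 'a set \<Rightarrow> 'a set" where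
  "minkowski_comb a b K L = {a *\<^sub>R x + b *\<^sub>R y | x y. x \<in> K \<and> y \<in> L}"

lemma minkowski_combI: "x \<in> K \<Longrightarrow> y \<in> L \<Longrightarrow> a *\<^sub>R x + b *\<^sub>R y \<in> minkowski_comb a b K L"
  unfolding minkowski_comb_def by blast

lemma minkowski_comb_mono:
  "K \<subseteq> K' \<Longrightarrow> L \<subseteq> L' \<Longrightarrow> minkowski_comb a b K L \<subseteq> minkowski_comb a b K' L'"
  unfolding minkowski_comb_def by blast

lemma compact_minkowski_comb:
  fixes K L :: "'a::real_normed_vector set"
  assumes "compact K" "compact L"
  shows "compact (minkowski_comb a b K L)"
proof -
  have "minkowski_comb a b K L = (\<lambda>z. a *\<^sub>R fst z + b *\<^sub>R snd z) ` (K \<times> L)"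
    unfolding minkowski_comb_def by force
  moreover have "compact ((\<lambda>z. a *\<^sub>R fst z + b *\<^sub>R snd z) ` (K \<times> L))"
    by (intro compact_continuous_image continuous_intros compact_Times assms)
  ultimately show ?thesis by simp
qed

lemma vector_eq_axis: "vector [s, t] = s *\<^sub>R axis 1 1 + t *\<^sub>R (axis 2 1 :: real^2)"
  by (simp add: vec_eq_iff forall_2 axis_def)

lemma borel_measurable_vector:
  "(\<lambda>(s, t). vector [s, t] :: real^2) \<in> borel_measurable (lborel \<Otimes>\<^sub>M lborel)"
proof -
  have "continuous_on UNIV (\<lambda>z::real \<times> real. vector [fst z, snd z] :: real^2)"
    unfolding vector_eq_axis by (intro continuous_intros)
  then show ?thesis
    using borel_measurable_continuous_onI by (force simp: lborel_prod case_prod_unfold)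
qed

text \<open>Planar Lebesgue measure as a product measure, so that Tonelli's theorem gives areas by slices.\<close>

lemma lborel_plane:
  "(lborel :: (real^2) measure) = distr (lborel \<Otimes>\<^sub>M lborel) borel (\<lambda>(s, t). vector [s, t])"
proof (rule lborel_eqI)
  fix l u :: "real^2"
  assume "\<And>b. b \<in> Basis \<Longrightarrow> l \<bullet> b \<le> u \<bullet> b"
  then have le: "l $ i \<le> u $ i" for i
    by (metis axis_in_Basis_iff cart_eq_inner_axis real_scaleR_def Basis_real_def insertI1)
  have "(\<lambda>(s, t). vector [s, t] :: real^2) -` box l u \<inter> space (lborel \<Otimes>\<^sub>M lborel)
      = {l$1<..<u$1} \<times> {l$2<..<u$2}"
    by (auto simp: mem_box_cart forall_2 space_pair_measure)
  then have "emeasure (distr (lborel \<Otimes>\<^sub>M lborel) borel (\<lambda>(s, t). vector [s, t])) (box l u)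
      = emeasure (lborel \<Otimes>\<^sub>M lborel) ({l$1<..<u$1} \<times> {l$2<..<u$2})"
    using borel_measurable_vector by (subst emeasure_distr) auto
  also have "\<dots> = ennreal ((u$1 - l$1) * (u$2 - l$2))"
    using le by (subst lborel.emeasure_pair_measure_Times) (auto simp: ennreal_mult)
  also have "(u$1 - l$1) * (u$2 - l$2) = (\<Prod>b\<in>Basis. (u - l) \<bullet> b)"
  proof -
    have B: "(Basis :: (real^2) set) = {axis 1 1, axis 2 1}"
      by (auto simp: Basis_vec_def) (metis exhaust_2)
    have "axis 1 (1::real) \<noteq> (axis 2 1 :: real^2)" by (simp add: axis_eq_axis)
    then show ?thesis unfolding B by (simp add: inner_axis)
  qed
  finally show "emeasure (distr (lborel \<Otimes>\<^sub>M lborel) borel (\<lambda>(s, t). vector [s, t])) (box l u)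
      = (\<Prod>b\<in>Basis. (u - l) \<bullet> b)" .
qed simp

lemma emeasure_plane_slices:
  fixes K :: "(real^2) set"
  assumes "compact K"
  shows "(\<lambda>s. emeasure lborel {t. vector [s, t] \<in> K}) \<in> borel_measurable lborel"
    and "emeasure lborel K = (\<integral>\<^sup>+s. emeasure lborel {t. vector [s, t] \<in> K} \<partial>lborel)"
proof -
  let ?f = "\<lambda>(s, t). vector [s, t] :: real^2"
  have K: "K \<in> sets borel" using assms by (simp add: borel_compact)
  have S: "?f -` K \<in> sets (lborel \<Otimes>\<^sub>M lborel)"
    using measurable_sets[OF borel_measurable_vector K] by (simp add: space_pair_measure)
  have sl: "Pair s -` (?f -` K) = {t. vector [s, t] \<in> K}" for s by auto
  show "(\<lambda>s. emeasure lborel {t. vector [s, t] \<in> K}) \<in> borel_measurable lborel"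
    using lborel.measurable_emeasure_Pair[OF S] unfolding sl .
  have "emeasure lborel K = emeasure (lborel \<Otimes>\<^sub>M lborel) (?f -` K)"
    using K borel_measurable_vector by (subst lborel_plane, subst emeasure_distr) (auto simp: space_pair_measure)
  also have "\<dots> = (\<integral>\<^sup>+s. emeasure lborel {t. vector [s, t] \<in> K} \<partial>lborel)"
    using lborel.emeasure_pair_measure_alt[OF S] unfolding sl .
  finally show "emeasure lborel K = (\<integral>\<^sup>+s. emeasure lborel {t. vector [s, t] \<in> K} \<partial>lborel)" .
qed

lemma compact_slice:
  fixes K :: "(real^2) set"
  assumes "compact K"
  shows "compact {t. vector [s, t] \<in> K}"
proof -
  have "{t. vector [s, t] \<in> K} = (\<lambda>x. x $ 2) ` (K \<inter> {x. x $ 1 = s})"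
  proof (intro set_eqI iffI)
    fix t assume "t \<in> {t. vector [s, t] \<in> K}"
    then show "t \<in> (\<lambda>x. x $ 2) ` (K \<inter> {x. x $ 1 = s})"
      by (intro image_eqI[where x="vector [s, t]"]) auto
  next
    fix t assume "t \<in> (\<lambda>x. x $ 2) ` (K \<inter> {x. x $ 1 = s})"
    then obtain x where "x \<in> K" "s = x $ 1" "t = x $ 2" by auto
    moreover have "vector [x $ 1, x $ 2] = x" by (simp add: vec_eq_iff forall_2)
    ultimately show "t \<in> {t. vector [s, t] \<in> K}" by simp
  qed
  moreover have "closed {x::real^2. x $ 1 = s}"
    by (intro closed_Collect_eq continuous_intros)
  ultimately show ?thesis
    by (auto intro!: compact_continuous_image continuous_intros compact_Int_closed assms)
qed

lemma vector_comb:
  "vector [a * s + b * s', a * t + b * t'] = a *\<^sub>R (vector [s, t] :: real^2) + b *\<^sub>R vector [s', t']"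
  by (simp add: vec_eq_iff forall_2)

lemma convex_slice:
  fixes K :: "(real^2) set"
  assumes "convex K"
  shows "convex {t. vector [s, t] \<in> K}"
proof (rule convexI)
  fix t t' and a b :: real
  assume "t \<in> {t. vector [s, t] \<in> K}" "t' \<in> {t. vector [s, t] \<in> K}" and ab: "0 \<le> a" "0 \<le> b" "a + b = 1"
  then have "a *\<^sub>R (vector [s, t] :: real^2) + b *\<^sub>R vector [s, t'] \<in> K"
    using assms by (auto intro: convexD)
  moreover have "a * s + b * s = s" using ab by (simp flip: distrib_right)
  ultimately show "a *\<^sub>R t + b *\<^sub>R t' \<in> {t. vector [s, t] \<in> K}"
    using vector_comb[of a s b s t t'] by simp
qed

text \<open>The one-dimensional Brunn-Minkowski inequality, which is linear in the lengths.\<close>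

lemma length_minkowski_comb:
  fixes A B C :: "real set"
  assumes A: "compact A" "convex A" "A \<noteq> {}" and B: "compact B" "convex B" "B \<noteq> {}"
    and C: "C \<in> sets borel" "minkowski_comb a b A B \<subseteq> C" and ab: "a \<ge> 0" "b \<ge> 0"
  shows "ennreal a * emeasure lborel A + ennreal b * emeasure lborel B \<le> emeasure lborel C"
proof -
  obtain p q where 1: "A = {p..q}" using A connected_compact_interval_1 convex_connected by blast
  obtain u v where 2: "B = {u..v}" using B connected_compact_interval_1 convex_connected by blast
  have le: "p \<le> q" "u \<le> v" using A(3) B(3) 1 2 by auto
  have "{a * p + b * u .. a * q + b * v} \<subseteq> C"
  proof -
    have "connected (minkowski_comb a b A B)" 
    proof -
      have "minkowski_comb a b A B = (\<lambda>z. a *\<^sub>R fst z + b *\<^sub>R snd z) ` (A \<times> B)"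
        unfolding minkowski_comb_def by force
      moreover have "connected ((\<lambda>z. a *\<^sub>R fst z + b *\<^sub>R snd z) ` (A \<times> B))"
        using A B by (intro connected_continuous_image continuous_intros connected_Times convex_connected)
      ultimately show ?thesis by simp
    qed
    moreover have "a * p + b * u \<in> minkowski_comb a b A B" "a * q + b * v \<in> minkowski_comb a b A B"
      using le minkowski_combI[of p A u B a b] minkowski_combI[of q A v B a b] 1 2 by auto
    ultimately show ?thesis using C(2) connected_contains_Icc by blast
  qed
  then have "emeasure lborel {a * p + b * u .. a * q + b * v} \<le> emeasure lborel C"
    using C by (intro emeasure_mono) auto
  moreover have "emeasure lborel {a * p + b * u .. a * q + b * v} = ennreal (a * (q - p) + b * (v - u))"
  proof -
    have "a * p + b * u \<le> a * q + b * v" using le ab by (intro add_mono mult_left_mono)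
    then show ?thesis by (simp add: algebra_simps)
  qed
  moreover have "\<dots> = ennreal a * emeasure lborel A + ennreal b * emeasure lborel B"
    using le ab 1 2 by (simp add: ennreal_plus ennreal_mult)
  ultimately show ?thesis by simp
qed

text \<open>
  Bodies with equal projections have nonempty fibres over the same points, and a
  combination of fibres over \<open>s\<close> lies in the fibre of the combination over \<open>s\<close> again.
\<close>

lemma area_comb_equal_projection_axis:
  fixes K L :: "(real^2) set"
  assumes K: "compact K" "convex K" and L: "compact L" "convex L"
    and proj: "(\<lambda>x. x $ 1) ` K = (\<lambda>x. x $ 1) ` L"
    and ab: "a \<ge> 0" "b \<ge> 0" "a + b = 1"
  shows "a * vol K + b * vol L \<le> vol (minkowski_comb a b K L)"
proof -
  let ?P = "minkowski_comb a b K L"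
  let ?S = "\<lambda>K s. {t. (vector [s, t] :: real^2) \<in> K}"
  have P: "compact ?P" by (rule compact_minkowski_comb) fact+
  have ne: "?S M s \<noteq> {} \<longleftrightarrow> s \<in> (\<lambda>x. x $ 1) ` M" for M s
  proof
    assume "?S M s \<noteq> {}"
    then obtain t where "vector [s, t] \<in> M" by blast
    then show "s \<in> (\<lambda>x. x $ 1) ` M" by (intro image_eqI[where x="vector [s, t]"]) auto
  next
    assume "s \<in> (\<lambda>x. x $ 1) ` M"
    then obtain x where "x \<in> M" "s = x $ 1" by auto
    moreover have "vector [x $ 1, x $ 2] = x" by (simp add: vec_eq_iff forall_2)
    ultimately have "x $ 2 \<in> ?S M s" by simp
    then show "?S M s \<noteq> {}" by blast
  qed
  have slice: "ennreal a * emeasure lborel (?S K s) + ennreal b * emeasure lborel (?S L s)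
      \<le> emeasure lborel (?S ?P s)" for s
  proof (cases "?S K s = {}")
    case True
    then have "?S L s = {}" using ne proj by metis
    with True show ?thesis by simp
  next
    case False
    then have nL: "?S L s \<noteq> {}" using ne proj by metis
    have "minkowski_comb a b (?S K s) (?S L s) \<subseteq> ?S ?P s"
    proof
      fix z assume "z \<in> minkowski_comb a b (?S K s) (?S L s)"
      then obtain t t' where t: "vector [s, t] \<in> K" "vector [s, t'] \<in> L" "z = a * t + b * t'"
        unfolding minkowski_comb_def by auto
      have "a * s + b * s = s" using ab by (simp flip: distrib_right)
      then show "z \<in> ?S ?P s"
        using minkowski_combI[OF t(1,2), of a b] vector_comb[of a s b s t t'] t(3) by simp
    qed
    moreover have "?S ?P s \<in> sets borel" using compact_slice[OF P] by (simp add: borel_compact)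
    ultimately show ?thesis
      using False nL K L ab by (intro length_minkowski_comb compact_slice convex_slice) auto
  qed
  have "ennreal a * emeasure lborel K + ennreal b * emeasure lborel L
      = (\<integral>\<^sup>+s. ennreal a * emeasure lborel (?S K s) + ennreal b * emeasure lborel (?S L s) \<partial>lborel)"
    using emeasure_plane_slices(1)[OF K(1)] emeasure_plane_slices(1)[OF L(1)]
    unfolding emeasure_plane_slices(2)[OF K(1)] emeasure_plane_slices(2)[OF L(1)]
    by (simp add: nn_integral_add nn_integral_cmult)
  also have "\<dots> \<le> (\<integral>\<^sup>+s. emeasure lborel (?S ?P s) \<partial>lborel)"
    by (intro nn_integral_mono slice)
  also have "\<dots> = emeasure lborel ?P" by (rule emeasure_plane_slices(2)[OF P, symmetric])
  finally have le: "ennreal a * emeasure lborel K + ennreal b * emeasure lborel L \<le> emeasure lborel ?P" .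
  have v: "emeasure lborel M = ennreal (vol M)" if "compact M" for M :: "(real^2) set"
  proof -
    have "M \<in> lmeasurable" using that by (rule lmeasurable_compact)
    moreover have "emeasure lborel M = emeasure lebesgue M"
      using that by (simp add: borel_compact)
    ultimately show ?thesis by (simp add: emeasure_eq_measure2)
  qed
  from le show ?thesis
    using ab unfolding v[OF K(1)] v[OF L(1)] v[OF P]
    by (simp add: ennreal_mult[symmetric] ennreal_plus[symmetric] ennreal_le_iff del: ennreal_plus)
qed

lemma area_comb_equal_projection:
  fixes K L :: "(real^2) set"
  assumes K: "compact K" "convex K" and L: "compact L" "convex L"
    and w: "w \<noteq> 0" and proj: "(\<lambda>x. x \<bullet> w) ` K = (\<lambda>x. x \<bullet> w) ` L"
    and ab: "a \<ge> 0" "b \<ge> 0" "a + b = 1"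
  shows "a * vol K + b * vol L \<le> vol (minkowski_comb a b K L)"
proof -
  have "norm w = norm (norm w *\<^sub>R axis 1 1 :: real^2)" by (simp add: norm_axis_1)
  then obtain f :: "real^2 \<Rightarrow> real^2" where f: "orthogonal_transformation f" "f w = norm w *\<^sub>R axis 1 1"
    using orthogonal_transformation_exists by blast
  then have lin: "linear f" by (simp add: orthogonal_transformation_linear)
  have coord: "f x $ 1 = (x \<bullet> w) / norm w" for x
  proof -
    have "x \<bullet> w = f x \<bullet> f w" using f(1) by (simp add: orthogonal_transformation_def)
    also have "\<dots> = norm w * f x $ 1" using f(2) by (simp add: inner_axis)
    finally show ?thesis using w by simp
  qed
  have "(\<lambda>x. x $ 1) ` f ` M = (\<lambda>s. s / norm w) ` (\<lambda>x. x \<bullet> w) ` M" for M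
    by (simp add: image_image coord)
  then have proj': "(\<lambda>x. x $ 1) ` f ` K = (\<lambda>x. x $ 1) ` f ` L" using proj by simp
  have im: "f ` minkowski_comb a b K L = minkowski_comb a b (f ` K) (f ` L)"
  proof (intro set_eqI iffI)
    fix z assume "z \<in> f ` minkowski_comb a b K L"
    then obtain x y where "x \<in> K" "y \<in> L" "z = f (a *\<^sub>R x + b *\<^sub>R y)"
      unfolding minkowski_comb_def by blast
    then show "z \<in> minkowski_comb a b (f ` K) (f ` L)"
      by (simp add: linear_add[OF lin] linear_scale[OF lin] minkowski_combI)
  next
    fix z assume "z \<in> minkowski_comb a b (f ` K) (f ` L)"
    then obtain x y where xy: "x \<in> K" "y \<in> L" "z = a *\<^sub>R f x + b *\<^sub>R f y"
      unfolding minkowski_comb_def by blast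
    then have "z = f (a *\<^sub>R x + b *\<^sub>R y)"
      by (simp add: linear_add[OF lin] linear_scale[OF lin])
    then show "z \<in> f ` minkowski_comb a b K L" using xy minkowski_combI by blast
  qed
  have cK: "compact (f ` K)" "convex (f ` K)" "compact (f ` L)" "convex (f ` L)"
    using K L lin compact_continuous_image[OF linear_continuous_on[OF linear_conv_bounded_linear[THEN iffD1, OF lin]]]
    by (simp_all add: convex_linear_image)
  have m: "vol (f ` M) = vol M" if "compact M" for M
    using measure_orthogonal_image[OF f(1)] lmeasurable_compact[OF that] by blast
  show ?thesis
    using area_comb_equal_projection_axis[OF cK proj' ab] unfolding im[symmetric]
    using m K L compact_minkowski_comb[OF K(1) L(1)] by simp
qed

section \<open>Support functions and contact directions\<close>

lemma support_fun_le:
  assumes "convex_body K" "x \<in> K" shows "x \<bullet> v \<le> support_fun K v"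
  using support_fun_max(2)[OF assms(1)] assms(2) by blast

lemma support_fun_attained:
  assumes "convex_body K" obtains x where "x \<in> K" "support_fun K v = x \<bullet> v"
  using support_fun_max(1)[OF assms, of v] by blast

lemma support_fun_scaleR:
  assumes K: "convex_body K" and t: "t \<ge> 0"
  shows "support_fun K (t *\<^sub>R v) = t * support_fun K v"
proof (rule antisym)
  obtain x where x: "x \<in> K" "support_fun K (t *\<^sub>R v) = x \<bullet> (t *\<^sub>R v)"
    by (rule support_fun_attained[OF K])
  show "support_fun K (t *\<^sub>R v) \<le> t * support_fun K v"
    using x support_fun_le[OF K x(1), of v] t by (simp add: mult_left_mono)
  obtain y where y: "y \<in> K" "support_fun K v = y \<bullet> v"
    by (rule support_fun_attained[OF K])
  show "t * support_fun K v \<le> support_fun K (t *\<^sub>R v)"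
    using y support_fun_le[OF K y(1), of "t *\<^sub>R v"] by simp
qed

lemma continuous_on_support_fun:
  fixes K :: "'a::euclidean_space set"
  assumes K: "convex_body K" shows "continuous_on S (support_fun K)"
proof -
  have "convex_on UNIV (support_fun K)"
  proof (rule convex_onI)
    fix t :: real and x y :: 'a
    assume t: "0 < t" "t < 1"
    obtain z where z: "z \<in> K" "support_fun K ((1 - t) *\<^sub>R x + t *\<^sub>R y) = z \<bullet> ((1 - t) *\<^sub>R x + t *\<^sub>R y)"
      by (rule support_fun_attained[OF K])
    have "(1 - t) * (z \<bullet> x) \<le> (1 - t) * support_fun K x" "t * (z \<bullet> y) \<le> t * support_fun K y"
      using t support_fun_le[OF K z(1)] by (simp_all add: mult_left_mono)
    with z(2) show "support_fun K ((1 - t) *\<^sub>R x + t *\<^sub>R y) \<le> (1 - t) * support_fun K x + t * support_fun K y"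
      by (simp add: inner_add_right)
  qed simp
  then show ?thesis
    using convex_on_continuous[of UNIV "support_fun K"] continuous_on_subset by blast
qed

lemma mem_iff_support_fun:
  fixes K :: "'a::euclidean_space set"
  assumes K: "convex_body K"
  shows "x \<in> K \<longleftrightarrow> (\<forall>v\<in>sphere 0 1. x \<bullet> v \<le> support_fun K v)"
proof
  assume "x \<in> K"
  then show "\<forall>v\<in>sphere 0 1. x \<bullet> v \<le> support_fun K v" using support_fun_le[OF K] by blast
next
  assume le: "\<forall>v\<in>sphere 0 1. x \<bullet> v \<le> support_fun K v"
  show "x \<in> K"
  proof (rule ccontr)
    assume "x \<notin> K"
    moreover have "convex K" "closed K"
      using K by (auto simp: convex_body_def compact_imp_closed)
    ultimately obtain a b where ab: "a \<bullet> x < b" "\<forall>y\<in>K. a \<bullet> y > b"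
      using separating_hyperplane_closed_point[of K x] by blast
    obtain y0 where "y0 \<in> K" by (rule support_fun_attained[OF K])
    with ab have a: "a \<noteq> 0" by (metis inner_zero_left less_trans less_irrefl)
    define v where "v = - (1 / norm a) *\<^sub>R a"
    have v: "v \<in> sphere 0 1" using a by (simp add: v_def)
    obtain y where y: "y \<in> K" "support_fun K v = y \<bullet> v" by (rule support_fun_attained[OF K])
    have "a \<bullet> x < a \<bullet> y" using ab y by fastforce
    then have "(a \<bullet> x) / norm a < (a \<bullet> y) / norm a" using a by (simp add: divide_strict_right_mono)
    then have "y \<bullet> v < x \<bullet> v" by (simp add: v_def inner_commute)
    with le v y show False by fastforce
  qed
qed

text \<open>
  If the origin could be separated from all common normals, then a small translation would
  move \<open>L\<close> away from the boundary of \<open>K\<close> in all contact directions, and there would be room to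
  enlarge \<open>L\<close>.
\<close>

lemma contact_directions:
  fixes K L :: "'a::euclidean_space set"
  assumes K: "convex_body K" and L: "convex_body L" and sub: "L \<subseteq> K"
    and max: "\<And>x t. homothet x t L \<subseteq> K \<Longrightarrow> t \<le> 1"
  shows "0 \<in> convex hull {v \<in> sphere 0 1. support_fun K v = support_fun L v}"
proof (rule ccontr)
  let ?g = "\<lambda>v. support_fun K v - support_fun L v"
  define V where "V = {v \<in> sphere 0 1. support_fun K v = support_fun L v}"
  assume "0 \<notin> convex hull {v \<in> sphere 0 1. support_fun K v = support_fun L v}"
  then have nV: "0 \<notin> convex hull V" by (simp add: V_def)
  note cont = continuous_on_support_fun[OF K] continuous_on_support_fun[OF L]
  have "closed {v. support_fun K v = support_fun L v}"
    by (intro closed_Collect_eq cont)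
  then have "compact (sphere 0 1 \<inter> {v. support_fun K v = support_fun L v})"
    by (intro compact_Int_closed compact_sphere)
  moreover have "V = sphere 0 1 \<inter> {v. support_fun K v = support_fun L v}" by (auto simp: V_def)
  ultimately have "compact V" by simp
  then have "closed (convex hull V)" by (intro compact_imp_closed compact_convex_hull)
  then obtain a b where ab: "a \<noteq> 0" "b > 0" "\<forall>v\<in>convex hull V. a \<bullet> v > b"
    using separating_hyperplane_closed_0[OF convex_convex_hull _ nV] by blast
  \<comment> \<open>On \<open>A\<close>, which has no contact directions, there is a uniform gap \<open>e\<close> between the support
    functions; off \<open>A\<close>, translation by \<open>- d a\<close> creates a gap of at least \<open>d b\<close>.\<close>
  define A where "A = sphere 0 1 \<inter> {v. a \<bullet> v \<le> b}"
  have "closed {v. a \<bullet> v \<le> b}" by (rule closed_halfspace_le)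
  then have cA: "compact A" unfolding A_def by (intro compact_Int_closed compact_sphere)
  have g0: "?g v \<ge> 0" for v
  proof -
    obtain y where "y \<in> L" "support_fun L v = y \<bullet> v" by (rule support_fun_attained[OF L])
    with support_fun_le[OF K, of y v] sub show ?thesis by auto
  qed
  have gA: "?g v > 0" if "v \<in> A" for v
  proof -
    have "v \<notin> V" using that ab(3) hull_subset[of V convex] by (force simp: A_def)
    with that have "?g v \<noteq> 0" by (auto simp: V_def A_def)
    with g0[of v] show ?thesis by linarith
  qed
  obtain e where e: "e > 0" "\<And>v. v \<in> A \<Longrightarrow> e \<le> ?g v"
  proof (cases "A = {}")
    case True
    then show ?thesis using that[of 1] by simp
  next
    case False
    then obtain v0 where "v0 \<in> A" "\<forall>v\<in>A. ?g v0 \<le> ?g v"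
      using continuous_attains_inf[OF cA, of ?g] cont by (auto intro: continuous_on_diff)
    then show ?thesis using that[of "?g v0"] gA by blast
  qed
  have "bounded L" using L by (simp add: convex_body_def compact_imp_bounded)
  then obtain M where M: "M > 0" "\<And>y. y \<in> L \<Longrightarrow> norm y \<le> M" unfolding bounded_pos by blast
  have hM: "support_fun L v \<le> M" if "v \<in> sphere 0 1" for v
  proof -
    obtain y where y: "y \<in> L" "support_fun L v = y \<bullet> v" by (rule support_fun_attained[OF L])
    have "y \<bullet> v \<le> norm y * norm v" by (rule norm_cauchy_schwarz)
    then show ?thesis using M(2)[OF y(1)] y(2) that by simp
  qed
  define d where "d = e / (2 * norm a)"
  have d: "d > 0" using e ab by (simp add: d_def)
  define s where "s = min (e / 2) (d * b) / M"
  have s: "s > 0" "s * M \<le> e / 2" "s * M \<le> d * b"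
    using e d ab M by (auto simp: s_def)
  have "homothet (- d *\<^sub>R a) (1 + s) L \<subseteq> K"
  proof
    fix z assume "z \<in> homothet (- d *\<^sub>R a) (1 + s) L"
    then obtain y where y: "y \<in> L" "z = - d *\<^sub>R a + (1 + s) *\<^sub>R y" by blast
    show "z \<in> K" unfolding mem_iff_support_fun[OF K]
    proof
      fix v :: 'a assume v: "v \<in> sphere 0 1"
      have "(1 + s) * (y \<bullet> v) \<le> (1 + s) * support_fun L v"
        using s support_fun_le[OF L y(1)] by (intro mult_left_mono) auto
      also have "\<dots> \<le> support_fun L v + s * M"
        using s hM[OF v] by (simp add: algebra_simps)
      finally have 1: "z \<bullet> v \<le> support_fun L v + s * M - d * (a \<bullet> v)"
        by (simp add: y(2) inner_diff_left inner_add_left)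
      show "z \<bullet> v \<le> support_fun K v"
      proof (cases "v \<in> A")
        case True
        have "- (a \<bullet> v) \<le> norm a"
          using norm_cauchy_schwarz[of "- a" v] v by simp
        then have "d * (- (a \<bullet> v)) \<le> d * norm a" using d by (intro mult_left_mono) auto
        also have "\<dots> = e / 2" using ab by (simp add: d_def)
        finally show ?thesis using 1 s e(2)[OF True] by simp
      next
        case False
        then have "d * b \<le> d * (a \<bullet> v)" using v d by (auto simp: A_def intro: mult_left_mono)
        then show ?thesis using 1 s g0[of v] by linarith
      qed
    qed
  qed
  then show False using max s(1) by fastforce
qed

text \<open>
  Caratheodory's theorem for unit vectors in the plane: after discarding zero coefficients,
  a single vector is impossible, and two vectors must be opposite.
\<close>

lemma zero_in_hull_plane:
  fixes V :: "(real^2) set"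
  assumes V: "V \<subseteq> sphere 0 1" and z: "0 \<in> convex hull V"
  shows "(\<exists>v\<in>V. - v \<in> V) \<or> (\<exists>u\<in>V. \<exists>v\<in>V. \<exists>w\<in>V. \<exists>a>0. \<exists>b>0. \<exists>c>0.
           a *\<^sub>R u + b *\<^sub>R v + c *\<^sub>R w = (0::real^2))"
proof -
  obtain S where S: "finite S" "S \<subseteq> V" "card S \<le> 3" "0 \<in> convex hull S"
    using z unfolding caratheodory[of V] by auto
  obtain c where c: "\<forall>v\<in>S. 0 \<le> c v" "sum c S = 1" "(\<Sum>v\<in>S. c v *\<^sub>R v) = 0"
    using S(4) unfolding convex_hull_finite[OF S(1)] by blast
  define T where "T = {v\<in>S. c v > 0}"
  have T: "finite T" "T \<subseteq> V" "card T \<le> 3"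
    using S card_mono[of S T] by (auto simp: T_def)
  have pos: "c v > 0" if "v \<in> T" for v using that by (simp add: T_def)
  have "(\<Sum>v\<in>T. c v *\<^sub>R v) = (\<Sum>v\<in>S. c v *\<^sub>R v)"
    using S(1) c(1) by (intro sum.mono_neutral_left) (auto simp: T_def)
  with c(3) have sum0: "(\<Sum>v\<in>T. c v *\<^sub>R v) = 0" by simp
  have "sum c T = sum c S"
    using S(1) c(1) by (intro sum.mono_neutral_left) (auto simp: T_def)
  with c(2) have "T \<noteq> {}" by auto
  then have "card T \<noteq> 0" using T by simp
  with T(3) consider "card T = 1" | "card T = 2" | "card T = 3" by linarith
  then show ?thesis
  proof cases
    case 1
    then obtain v where v: "T = {v}" by (auto simp: card_1_singleton_iff)
    then have "c v *\<^sub>R v = 0" "v \<in> V" "c v > 0" using sum0 T(2) pos by auto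
    then show ?thesis using V by auto
  next
    case 2
    then obtain u v where uv: "T = {u, v}" "u \<noteq> v" by (auto simp: card_2_iff)
    then have eq: "c u *\<^sub>R u = - (c v *\<^sub>R v)" using sum0 by (simp add: add_eq_0_iff2)
    have n: "norm u = 1" "norm v = 1" "u \<in> V" "v \<in> V" using uv T(2) V by auto
    have p: "c u > 0" "c v > 0" using pos uv by auto
    have "norm (c u *\<^sub>R u) = norm (c v *\<^sub>R v)" using eq by simp
    then have "c u = c v" using n p by simp
    then have "c u *\<^sub>R u = c u *\<^sub>R (- v)" using eq by simp
    then have "u = - v" using p by (simp only: scaleR_cancel_left) auto
    then show ?thesis using n by blast
  next
    case 3
    then obtain u v w where uvw: "T = {u, v, w}" "u \<noteq> v" "u \<noteq> w" "v \<noteq> w" by (auto simp: card_3_iff)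
    then have "c u *\<^sub>R u + c v *\<^sub>R v + c w *\<^sub>R w = 0" using sum0 by (simp add: add.assoc)
    moreover have "u \<in> V" "v \<in> V" "w \<in> V" "c u > 0" "c v > 0" "c w > 0"
      using uvw T(2) pos by auto
    ultimately show ?thesis by blast
  qed
qed

section \<open>An area inequality for maximal homothetic copies\<close>

text \<open>The inequality may be verified separately on the two sides of a line.\<close>

lemma area_comb_cut:
  fixes K L :: "(real^2) set"
  assumes K: "compact K" and L: "compact L" and n: "n \<noteq> 0"
    and ab: "a \<ge> 0" "b \<ge> 0" "a + b = 1"
    and le: "a * vol (K \<inter> {x. x \<bullet> n \<le> c}) + b * vol (L \<inter> {x. x \<bullet> n \<le> c})
      \<le> vol (minkowski_comb a b (K \<inter> {x. x \<bullet> n \<le> c}) (L \<inter> {x. x \<bullet> n \<le> c}))"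
    and ge: "a * vol (K \<inter> {x. c \<le> x \<bullet> n}) + b * vol (L \<inter> {x. c \<le> x \<bullet> n})
      \<le> vol (minkowski_comb a b (K \<inter> {x. c \<le> x \<bullet> n}) (L \<inter> {x. c \<le> x \<bullet> n}))"
  shows "a * vol K + b * vol L \<le> vol (minkowski_comb a b K L)"
proof -
  let ?l = "{x. x \<bullet> n \<le> c}" and ?g = "{x. c \<le> x \<bullet> n}"
  have cl: "closed ?l" "closed ?g"
    by (auto intro!: closed_Collect_le continuous_intros)
  let ?Pl = "minkowski_comb a b (K \<inter> ?l) (L \<inter> ?l)" and ?Pg = "minkowski_comb a b (K \<inter> ?g) (L \<inter> ?g)"
  have split: "vol M \<le> vol (M \<inter> ?l) + vol (M \<inter> ?g)" if "compact M" for M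
  proof -
    have "vol ((M \<inter> ?l) \<union> (M \<inter> ?g)) \<le> vol (M \<inter> ?l) + vol (M \<inter> ?g)"
      using that cl by (intro measure_Un_le fmeasurableD lmeasurable_compact compact_Int_closed)
    moreover have "(M \<inter> ?l) \<union> (M \<inter> ?g) = M" by auto
    ultimately show ?thesis by simp
  qed
  have cP: "?Pl \<in> lmeasurable" "?Pg \<in> lmeasurable"
    using K L cl by (auto intro!: lmeasurable_compact compact_minkowski_comb compact_Int_closed)
  have "?Pl \<inter> ?Pg \<subseteq> {x. n \<bullet> x = c}"
  proof
    fix z assume z: "z \<in> ?Pl \<inter> ?Pg"
    then obtain x y where 1: "x \<bullet> n \<le> c" "y \<bullet> n \<le> c" "z = a *\<^sub>R x + b *\<^sub>R y"
      unfolding minkowski_comb_def by blast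
    from z obtain x' y' where 2: "c \<le> x' \<bullet> n" "c \<le> y' \<bullet> n" "z = a *\<^sub>R x' + b *\<^sub>R y'"
      unfolding minkowski_comb_def by blast
    have c: "a * c + b * c = c" using ab by (simp flip: distrib_right)
    have "a * (x \<bullet> n) + b * (y \<bullet> n) \<le> a * c + b * c" using 1 ab by (intro add_mono mult_left_mono)
    then have "z \<bullet> n \<le> c" unfolding 1(3) c by (simp add: inner_add_left)
    moreover have "a * c + b * c \<le> a * (x' \<bullet> n) + b * (y' \<bullet> n)" using 2 ab by (intro add_mono mult_left_mono)
    then have "c \<le> z \<bullet> n" unfolding 2(3) c by (simp add: inner_add_left)
    ultimately show "z \<in> {x. n \<bullet> x = c}" by (simp add: inner_commute)
  qed
  then have "negligible (?Pl \<inter> ?Pg)"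
    using negligible_hyperplane[of n c] n negligible_subset by blast
  then have "vol (?Pl \<inter> ?Pg) = 0" by (rule negligible_imp_measure0)
  then have "vol ?Pl + vol ?Pg = vol (?Pl \<union> ?Pg)"
    using measure_Un3[OF cP] by simp
  also have "\<dots> \<le> vol (minkowski_comb a b K L)"
    using cP K L minkowski_comb_mono[of "K \<inter> _" K "L \<inter> _" L a b]
    by (intro measure_mono_fmeasurable lmeasurable_compact compact_minkowski_comb) auto
  finally have P: "vol ?Pl + vol ?Pg \<le> vol (minkowski_comb a b K L)" .
  have "a * vol K \<le> a * (vol (K \<inter> ?l) + vol (K \<inter> ?g))"
    "b * vol L \<le> b * (vol (L \<inter> ?l) + vol (L \<inter> ?g))"
    using split[OF K] split[OF L] ab by (auto intro: mult_left_mono)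
  with le ge P show ?thesis by (simp add: distrib_left)
qed

lemma convex_inner_image:
  fixes M :: "'a::real_inner set"
  assumes "convex M" "q1 \<in> M" "q2 \<in> M"
    and "\<And>x. x \<in> M \<Longrightarrow> q1 \<bullet> w \<le> x \<bullet> w \<and> x \<bullet> w \<le> q2 \<bullet> w"
  shows "(\<lambda>x. x \<bullet> w) ` M = {q1 \<bullet> w .. q2 \<bullet> w}"
proof
  show "(\<lambda>x. x \<bullet> w) ` M \<subseteq> {q1 \<bullet> w .. q2 \<bullet> w}" using assms(4) by auto
  have "connected ((\<lambda>x. x \<bullet> w) ` M)"
    using assms(1) by (intro connected_continuous_image continuous_intros convex_connected)
  then show "{q1 \<bullet> w .. q2 \<bullet> w} \<subseteq> (\<lambda>x. x \<bullet> w) ` M"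
    using assms(2,3) by (intro connected_contains_Icc) auto
qed

lemma area_comb_between_points:
  fixes K L :: "(real^2) set"
  assumes K: "compact K" "convex K" and L: "compact L" "convex L"
    and q: "q1 \<in> K \<inter> L" "q2 \<in> K \<inter> L" and w: "w \<noteq> 0"
    and le: "\<And>x. x \<in> K \<union> L \<Longrightarrow> q1 \<bullet> w \<le> x \<bullet> w \<and> x \<bullet> w \<le> q2 \<bullet> w"
    and ab: "a \<ge> 0" "b \<ge> 0" "a + b = 1"
  shows "a * vol K + b * vol L \<le> vol (minkowski_comb a b K L)"
proof (rule area_comb_equal_projection[OF K L w _ ab])
  have "(\<lambda>x. x \<bullet> w) ` K = {q1 \<bullet> w .. q2 \<bullet> w}"
    using q le by (intro convex_inner_image K) blast+
  moreover have "(\<lambda>x. x \<bullet> w) ` L = {q1 \<bullet> w .. q2 \<bullet> w}"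
    using q le by (intro convex_inner_image L) blast+
  ultimately show "(\<lambda>x. x \<bullet> w) ` K = (\<lambda>x. x \<bullet> w) ` L" by simp
qed

text \<open>
  For boundary points \<open>q1\<close>, \<open>q2\<close> with outer normals \<open>v1\<close>, \<open>v2\<close>, the vector below is a
  normal of the chord from \<open>q1\<close> to \<open>q2\<close>. It is a nonnegative combination of \<open>v1\<close> and \<open>v2\<close>, so
  that it points from the chord to the cap beyond it. It vanishes in degenerate positions,
  for instance if \<open>q1 = q2\<close>.
\<close>

definition chord_normal :: "'a::real_inner \<Rightarrow> 'a \<Rightarrow> 'a \<Rightarrow> 'a \<Rightarrow> 'a" where
  "chord_normal q1 v1 q2 v2 = (v2 \<bullet> (q2 - q1)) *\<^sub>R v1 + (v1 \<bullet> (q1 - q2)) *\<^sub>R v2"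

lemma chord_normal_orthogonal: "q1 \<bullet> chord_normal q1 v1 q2 v2 = q2 \<bullet> chord_normal q1 v1 q2 v2"
  by (simp add: chord_normal_def inner_diff_right inner_add_right inner_commute algebra_simps)

text \<open>
  The cap beyond the chord may be cut off: with the coefficients \<open>A\<close>, \<open>B\<close> of the chord normal,
  the functional \<open>B v2 - A v1\<close> is bounded on the cap by its values at \<open>q1\<close> and \<open>q2\<close>. Hence the
  caps of \<open>K\<close> and \<open>L\<close> have the same projection, and only the rest needs to be considered.
\<close>

lemma area_comb_cut_cap:
  fixes K L :: "(real^2) set"
  assumes K: "compact K" "convex K" and L: "compact L" "convex L"
    and q: "q1 \<in> K \<inter> L" "q2 \<in> K \<inter> L"
    and v1: "\<And>x. x \<in> K \<union> L \<Longrightarrow> x \<bullet> v1 \<le> q1 \<bullet> v1"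
    and v2: "\<And>x. x \<in> K \<union> L \<Longrightarrow> x \<bullet> v2 \<le> q2 \<bullet> v2"
    and ab: "a \<ge> 0" "b \<ge> 0" "a + b = 1"
    and rest: "a * vol (K \<inter> {x. x \<bullet> chord_normal q1 v1 q2 v2 \<le> q1 \<bullet> chord_normal q1 v1 q2 v2})
        + b * vol (L \<inter> {x. x \<bullet> chord_normal q1 v1 q2 v2 \<le> q1 \<bullet> chord_normal q1 v1 q2 v2})
      \<le> vol (minkowski_comb a b
          (K \<inter> {x. x \<bullet> chord_normal q1 v1 q2 v2 \<le> q1 \<bullet> chord_normal q1 v1 q2 v2})
          (L \<inter> {x. x \<bullet> chord_normal q1 v1 q2 v2 \<le> q1 \<bullet> chord_normal q1 v1 q2 v2}))"
  shows "a * vol K + b * vol L \<le> vol (minkowski_comb a b K L)"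
proof (cases "chord_normal q1 v1 q2 v2 = 0")
  case True
  with rest show ?thesis by simp
next
  case False
  define n where "n = chord_normal q1 v1 q2 v2"
  define A where "A = v2 \<bullet> (q2 - q1)"
  define B where "B = v1 \<bullet> (q1 - q2)"
  define w where "w = B *\<^sub>R v2 - A *\<^sub>R v1"
  have n: "n = A *\<^sub>R v1 + B *\<^sub>R v2" by (simp add: n_def chord_normal_def A_def B_def)
  have AB: "A \<ge> 0" "B \<ge> 0"
    using v1[of q2] v2[of q1] q by (auto simp: A_def B_def inner_diff_right inner_commute)
  have nq: "q1 \<bullet> n = q2 \<bullet> n" unfolding n_def by (rule chord_normal_orthogonal)
  \<comment> \<open>\<open>w = 0\<close> would make \<open>n\<close> a multiple of both normals, and orthogonality to the chord gives \<open>A B = 0\<close>.\<close>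
  have "w \<noteq> 0"
  proof
    assume "w = 0"
    then have eq: "A *\<^sub>R v1 = B *\<^sub>R v2" by (simp add: w_def)
    have n2: "n = 2 *\<^sub>R (A *\<^sub>R v1)"
      unfolding n eq[symmetric] by (rule scaleR_2[symmetric])
    have "A * B = 0"
      using nq unfolding n2 B_def by (auto simp: inner_diff_right inner_commute)
    then have "A *\<^sub>R v1 = 0" using eq by auto
    then have "n = 0" using n2 by simp
    then show False using False by (simp add: n_def)
  qed
  let ?K = "K \<inter> {x. q1 \<bullet> n \<le> x \<bullet> n}" and ?L = "L \<inter> {x. q1 \<bullet> n \<le> x \<bullet> n}"
  have cl: "closed {x. q1 \<bullet> n \<le> x \<bullet> n}"
    by (auto intro!: closed_Collect_le continuous_intros)
  have cv: "convex {x. q1 \<bullet> n \<le> x \<bullet> n}"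
    using convex_halfspace_ge[of "q1 \<bullet> n" n] by (simp add: inner_commute)
  have "a * vol ?K + b * vol ?L \<le> vol (minkowski_comb a b ?K ?L)"
  proof (rule area_comb_between_points[OF _ _ _ _ _ _ \<open>w \<noteq> 0\<close> _ ab])
    show "q1 \<in> ?K \<inter> ?L" "q2 \<in> ?K \<inter> ?L" using q nq by auto
    fix x assume "x \<in> ?K \<union> ?L"
    then have x: "x \<in> K \<union> L" "q1 \<bullet> n \<le> x \<bullet> n" by auto
    have "A * (x \<bullet> v1) \<le> A * (q1 \<bullet> v1)" "B * (x \<bullet> v2) \<le> B * (q2 \<bullet> v2)"
      using AB v1[OF x(1)] v2[OF x(1)] by (auto intro: mult_left_mono)
    then show "q1 \<bullet> w \<le> x \<bullet> w \<and> x \<bullet> w \<le> q2 \<bullet> w"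
      using x(2) nq by (simp add: w_def n inner_add_right inner_diff_right)
  qed (use K L cl cv in \<open>auto intro: compact_Int_closed convex_Int\<close>)
  with area_comb_cut[OF K(1) L(1) _ ab, of n "q1 \<bullet> n"] rest False show ?thesis
    by (simp add: n_def)
qed

text \<open>
  The third contact point survives when the cap over the chord of the other two is cut off,
  provided the three normals are positively dependent.
\<close>

lemma third_contact_below_chord:
  fixes q1 q2 q3 v1 v2 v3 :: "'a::real_inner"
  assumes v1: "q2 \<bullet> v1 \<le> q1 \<bullet> v1" "q3 \<bullet> v1 \<le> q1 \<bullet> v1"
    and v2: "q1 \<bullet> v2 \<le> q2 \<bullet> v2" "q3 \<bullet> v2 \<le> q2 \<bullet> v2"
    and v3: "q1 \<bullet> v3 \<le> q3 \<bullet> v3" "q2 \<bullet> v3 \<le> q3 \<bullet> v3"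
    and c: "c1 > 0" "c2 > 0" "c3 > 0" "c1 *\<^sub>R v1 + c2 *\<^sub>R v2 + c3 *\<^sub>R v3 = 0"
  shows "q3 \<bullet> chord_normal q1 v1 q2 v2 \<le> q1 \<bullet> chord_normal q1 v1 q2 v2"
proof -
  define a where "a = (q3 - q1) \<bullet> v1"
  define b where "b = (q3 - q1) \<bullet> v2"
  define A where "A = v2 \<bullet> (q2 - q1)"
  define B where "B = v1 \<bullet> (q1 - q2)"
  have zero: "c1 * (x \<bullet> v1) + c2 * (x \<bullet> v2) + c3 * (x \<bullet> v3) = 0" for x
  proof -
    have "x \<bullet> (c1 *\<^sub>R v1 + c2 *\<^sub>R v2 + c3 *\<^sub>R v3) = 0" by (simp add: c(4))
    then show ?thesis by (simp add: inner_add_right)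
  qed
  have AB: "A \<ge> 0" "B \<ge> 0"
    using v1 v2 by (auto simp: A_def B_def inner_diff_right inner_commute)
  have ab: "a \<le> 0" "b \<le> A"
    using v1 v2 by (auto simp: a_def b_def A_def inner_diff_right inner_diff_left inner_commute)
  have "c3 * ((q3 - q1) \<bullet> v3) \<ge> 0" using v3 c by (simp add: inner_diff_left)
  with zero[of "q3 - q1"] have 1: "c1 * a + c2 * b \<le> 0" by (simp add: a_def b_def)
  have "c3 * ((q3 - q2) \<bullet> v3) \<ge> 0" using v3 c by (simp add: inner_diff_left)
  moreover have "(q3 - q2) \<bullet> v1 = a + B" "(q3 - q2) \<bullet> v2 = b - A"
    by (simp_all add: a_def b_def A_def B_def inner_diff_left inner_diff_right inner_commute)
  ultimately have 2: "c1 * (a + B) + c2 * (b - A) \<le> 0" using zero[of "q3 - q2"] by simp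
  have "A * a + B * b \<le> 0"
  proof (cases "b \<le> 0")
    case True
    with AB ab show ?thesis by (simp add: add_nonpos_nonpos mult_nonneg_nonpos)
  next
    case b: False
    show ?thesis
    proof (cases "a + B \<le> 0")
      case True
      have "B * b \<le> (- a) * A" using True b ab AB by (intro mult_mono) auto
      then show ?thesis by (simp add: mult.commute)
    next
      case False
      \<comment> \<open>The two bounds \<open>c1 (a + B) \<le> c2 (A - b)\<close> and \<open>c2 b \<le> - c1 a\<close> are multiplied.\<close>
      have "(c1 * (a + B)) * (c2 * b) \<le> (c2 * (A - b)) * (- (c1 * a))"
      proof (rule mult_mono)
        show "c1 * (a + B) \<le> c2 * (A - b)" using 2 by (simp add: right_diff_distrib)
        show "c2 * b \<le> - (c1 * a)" using 1 by simp
      qed (use b c ab in auto)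
      then have "(c1 * c2) * ((a + B) * b) \<le> (c1 * c2) * ((A - b) * (- a))"
        by (simp add: algebra_simps)
      then have "(a + B) * b \<le> (A - b) * (- a)"
        using c by (simp only: mult_le_cancel_left_pos mult_pos_pos)
      then show ?thesis by (simp add: algebra_simps)
    qed
  qed
  moreover have "q3 \<bullet> chord_normal q1 v1 q2 v2 - q1 \<bullet> chord_normal q1 v1 q2 v2 = A * a + B * b"
    by (simp add: chord_normal_def A_def B_def a_def b_def inner_diff_left inner_diff_right inner_add_right algebra_simps)
  ultimately show ?thesis by linarith
qed

text \<open>
  After cutting off the caps over the chords \<open>q1 q2\<close> and \<open>q2 q3\<close>, the remaining parts have the
  same projection along the line through \<open>q2\<close> and the intersection of the supporting lines at
  \<open>q1\<close> and \<open>q3\<close> (in general position). The functional \<open>w\<close> is constant on that line. Its extreme values on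
  the remaining parts are attained at \<open>q1\<close> and \<open>q3\<close> because \<open>w\<close> is a nonnegative combination of
  \<open>v1\<close> and the first chord normal, while \<open>- w\<close> is one of \<open>v3\<close> and the second chord normal.
\<close>

lemma area_comb_three_contacts:
  fixes K L :: "(real^2) set"
  assumes K: "compact K" "convex K" "interior K \<noteq> {}" and L: "compact L" "convex L"
    and q: "q1 \<in> K \<inter> L" "q2 \<in> K \<inter> L" "q3 \<in> K \<inter> L"
    and v1: "\<And>x. x \<in> K \<union> L \<Longrightarrow> x \<bullet> v1 \<le> q1 \<bullet> v1"
    and v2: "\<And>x. x \<in> K \<union> L \<Longrightarrow> x \<bullet> v2 \<le> q2 \<bullet> v2"
    and v3: "\<And>x. x \<in> K \<union> L \<Longrightarrow> x \<bullet> v3 \<le> q3 \<bullet> v3"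
    and c: "c1 > 0" "c2 > 0" "c3 > 0" "c1 *\<^sub>R v1 + c2 *\<^sub>R v2 + c3 *\<^sub>R v3 = 0"
    and v: "norm v1 = 1" "norm v2 = 1" "v1 \<noteq> - v2"
    and ab: "a \<ge> 0" "b \<ge> 0" "a + b = 1"
  shows "a * vol K + b * vol L \<le> vol (minkowski_comb a b K L)"
proof -
  have zero: "c1 * (x \<bullet> v1) + c2 * (x \<bullet> v2) + c3 * (x \<bullet> v3) = 0" for x
  proof -
    have "x \<bullet> (c1 *\<^sub>R v1 + c2 *\<^sub>R v2 + c3 *\<^sub>R v3) = 0" by (simp add: c(4))
    then show ?thesis by (simp add: inner_add_right)
  qed
  define n3 where "n3 = chord_normal q1 v1 q2 v2"
  define n1 where "n1 = chord_normal q2 v2 q3 v3"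
  define A3 where "A3 = v2 \<bullet> (q2 - q1)"
  define B3 where "B3 = v1 \<bullet> (q1 - q2)"
  define A1 where "A1 = v3 \<bullet> (q3 - q2)"
  define B1 where "B1 = v2 \<bullet> (q2 - q3)"
  \<comment> \<open>\<open>W\<close> is the sum of the \<open>c\<^sub>i (q\<^sub>i - x) \<bullet> v\<^sub>i\<close>, which does not depend on the point \<open>x\<close>; the
    definition is the case \<open>x = q2\<close>, and \<open>W3\<close>, \<open>W1\<close> are the cases \<open>x = q1\<close>, \<open>x = q3\<close>.\<close>
  define W where "W = c1 * B3 + c3 * A1"
  have n3: "n3 = A3 *\<^sub>R v1 + B3 *\<^sub>R v2" by (simp add: n3_def chord_normal_def A3_def B3_def)
  have n1: "n1 = A1 *\<^sub>R v2 + B1 *\<^sub>R v3" by (simp add: n1_def chord_normal_def A1_def B1_def)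
  have e3: "q1 \<bullet> n3 = q2 \<bullet> n3" unfolding n3_def by (rule chord_normal_orthogonal)
  have e1: "q2 \<bullet> n1 = q3 \<bullet> n1" unfolding n1_def by (rule chord_normal_orthogonal)
  note vq = v1[of q2] v1[of q3] v2[of q1] v2[of q3] v3[of q1] v3[of q2]
  have nonneg: "A3 \<ge> 0" "B3 \<ge> 0" "A1 \<ge> 0" "B1 \<ge> 0"
    using vq q by (auto simp: A3_def B3_def A1_def B1_def inner_diff_right inner_commute)
  have W3: "W = c2 * A3 + c3 * (q3 \<bullet> v3 - q1 \<bullet> v3)"
    using zero[of "q1 - q2"] unfolding W_def A1_def B3_def A3_def
    by (simp add: inner_diff_left inner_diff_right inner_commute algebra_simps)
  have W1: "W = c2 * B1 + c1 * (q1 \<bullet> v1 - q3 \<bullet> v1)"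
    using zero[of "q3 - q2"] unfolding W_def A1_def B3_def B1_def
    by (simp add: inner_diff_left inner_diff_right inner_commute algebra_simps)
  have "0 \<le> c3 * (q3 \<bullet> v3 - q1 \<bullet> v3)" "0 \<le> c1 * (q1 \<bullet> v1 - q3 \<bullet> v1)"
    using vq(2,5) q c by simp_all
  then have cA: "c2 * A3 \<le> W" "c2 * B1 \<le> W"
    using W3 W1 by linarith+
  \<comment> \<open>Evaluating the sum at an interior point of \<open>K\<close> shows that it is positive.\<close>
  have W: "W > 0"
  proof -
    obtain x e where x: "e > 0" "cball x e \<subseteq> K"
      using K(3) unfolding ex_in_conv[symmetric] mem_interior_cball by auto
    have "x + e *\<^sub>R v1 \<in> cball x e" using x(1) v by (simp add: dist_norm)
    then have "x + e *\<^sub>R v1 \<in> K \<union> L" using x by blast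
    from v1[OF this] have "x \<bullet> v1 + e \<le> q1 \<bullet> v1"
      using v(1) by (simp add: inner_add_left dot_square_norm)
    then have "c1 * (q1 \<bullet> v1 - x \<bullet> v1) > 0" using x(1) c by simp
    moreover have xK: "x \<in> K \<union> L" using x by auto
    have "c2 * (q2 \<bullet> v2 - x \<bullet> v2) \<ge> 0" "c3 * (q3 \<bullet> v3 - x \<bullet> v3) \<ge> 0"
      using v2[OF xK] v3[OF xK] c by simp_all
    moreover have "c1 * (q1 \<bullet> v1 - x \<bullet> v1) + c2 * (q2 \<bullet> v2 - x \<bullet> v2) + c3 * (q3 \<bullet> v3 - x \<bullet> v3) = W"
      using zero[of "q2 - x"] unfolding W_def A1_def B3_def
      by (simp add: inner_diff_left inner_diff_right inner_commute algebra_simps)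
    ultimately show ?thesis by linarith
  qed
  \<comment> \<open>These weights make the coefficients of \<open>v2\<close> in \<open>w\<close> and in the combination for \<open>- w\<close> add up to \<open>c2\<close>.\<close>
  define t where "t = c1 * c2 / W"
  define t' where "t' = c3 * c2 / W"
  define s where "s = c1 - t * A3"
  define s' where "s' = c3 - t' * B1"
  have t: "t \<ge> 0" "t' \<ge> 0" using c W by (auto simp: t_def t'_def)
  have "c1 * (c2 * A3) \<le> c1 * W" "c3 * (c2 * B1) \<le> c3 * W" using cA c by auto
  then have s: "s \<ge> 0" "s' \<ge> 0" using W by (auto simp: s_def s'_def t_def t'_def field_simps)
  define w where "w = s *\<^sub>R v1 + t *\<^sub>R n3"
  have w: "w = c1 *\<^sub>R v1 + (t * B3) *\<^sub>R v2"
    by (simp add: w_def n3 s_def algebra_simps)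
  have "t * B3 + t' * A1 = c2 * W / W"
    unfolding t_def t'_def W_def by (simp add: algebra_simps add_divide_distrib)
  then have tt: "t * B3 + t' * A1 = c2" using W by simp
  have "w + (s' *\<^sub>R v3 + t' *\<^sub>R n1) = c1 *\<^sub>R v1 + (t * B3 + t' * A1) *\<^sub>R v2 + c3 *\<^sub>R v3"
    by (simp add: w n1 s'_def algebra_simps)
  also have "\<dots> = 0" using tt c(4) by simp
  finally have w': "- w = s' *\<^sub>R v3 + t' *\<^sub>R n1" by (simp add: minus_unique)
  have w0: "w \<noteq> 0"
  proof
    assume "w = 0"
    then have eq: "c1 *\<^sub>R v1 = (t * B3) *\<^sub>R (- v2)" using w by (simp add: add_eq_0_iff2)
    then have "norm (c1 *\<^sub>R v1) = norm ((t * B3) *\<^sub>R (- v2))" by simp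
    then have "c1 = t * B3" using v c t nonneg by simp
    with eq c(1) have "v1 = - v2" by (metis less_irrefl scaleR_cancel_left)
    with v show False by simp
  qed
  let ?H3 = "{x. x \<bullet> n3 \<le> q1 \<bullet> n3}" and ?H1 = "{x. x \<bullet> n1 \<le> q2 \<bullet> n1}"
  have cl: "closed ?H3" "closed ?H1"
    by (auto intro!: closed_Collect_le continuous_intros)
  have cv: "convex ?H3" "convex ?H1"
    using convex_halfspace_le[of n3 "q1 \<bullet> n3"] convex_halfspace_le[of n1 "q2 \<bullet> n1"]
    by (simp_all add: inner_commute)
  have q3: "q3 \<in> ?H3"
    unfolding n3_def using third_contact_below_chord[of q2 v1 q1 q3 v2 v3 c1 c2 c3] vq q c by auto
  have "c2 *\<^sub>R v2 + c3 *\<^sub>R v3 + c1 *\<^sub>R v1 = 0" using c(4) by (simp add: add_ac)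
  then have q1: "q1 \<in> ?H1"
    unfolding n1_def using third_contact_below_chord[of q3 v2 q2 q1 v3 v1 c2 c3 c1] vq q c by auto
  have "a * vol ((K \<inter> ?H3) \<inter> ?H1) + b * vol ((L \<inter> ?H3) \<inter> ?H1)
      \<le> vol (minkowski_comb a b ((K \<inter> ?H3) \<inter> ?H1) ((L \<inter> ?H3) \<inter> ?H1))"
  proof (rule area_comb_between_points[OF _ _ _ _ _ _ w0 _ ab])
    show "q3 \<in> ((K \<inter> ?H3) \<inter> ?H1) \<inter> ((L \<inter> ?H3) \<inter> ?H1)" using q q3 e1 by auto
    show "q1 \<in> ((K \<inter> ?H3) \<inter> ?H1) \<inter> ((L \<inter> ?H3) \<inter> ?H1)" using q q1 by auto
    fix x assume "x \<in> ((K \<inter> ?H3) \<inter> ?H1) \<union> ((L \<inter> ?H3) \<inter> ?H1)"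
    then have x: "x \<in> K \<union> L" "x \<bullet> n3 \<le> q1 \<bullet> n3" "x \<bullet> n1 \<le> q3 \<bullet> n1" using e1 by auto
    have "s * (x \<bullet> v1) + t * (x \<bullet> n3) \<le> s * (q1 \<bullet> v1) + t * (q1 \<bullet> n3)"
      using s t x v1[OF x(1)] by (intro add_mono mult_left_mono) auto
    then have "x \<bullet> w \<le> q1 \<bullet> w" by (simp add: w_def inner_add_right)
    moreover have "s' * (x \<bullet> v3) + t' * (x \<bullet> n1) \<le> s' * (q3 \<bullet> v3) + t' * (q3 \<bullet> n1)"
      using s t x v3[OF x(1)] by (intro add_mono mult_left_mono) auto
    then have "x \<bullet> (- w) \<le> q3 \<bullet> (- w)" unfolding w' by (simp add: inner_add_right)
    ultimately show "q3 \<bullet> w \<le> x \<bullet> w \<and> x \<bullet> w \<le> q1 \<bullet> w" by simp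
  qed (use K L cl cv in \<open>auto intro: compact_Int_closed convex_Int\<close>)
  then have "a * vol (K \<inter> ?H3) + b * vol (L \<inter> ?H3)
      \<le> vol (minkowski_comb a b (K \<inter> ?H3) (L \<inter> ?H3))"
    unfolding n1_def
    by (rule area_comb_cut_cap[rotated -1])
      (use K L cl cv q q3 e3 v2 v3 ab in \<open>auto intro: compact_Int_closed convex_Int\<close>)
  then show ?thesis
    unfolding n3_def
    by (rule area_comb_cut_cap[rotated -1]) (use K L q v1 v2 ab in auto)
qed

text \<open>
  The Bonnesen type inequality. Equivalently, with \<open>V\<close> denoting mixed area, \<open>2 V(K, L) \<ge> |K| + |L|\<close>
  if \<open>L\<close> is a largest homothetic copy of itself in \<open>K\<close>.
\<close>

theorem area_comb_maximal_homothet: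
  fixes K L :: "(real^2) set"
  assumes K: "convex_body K" and L: "convex_body L" and sub: "L \<subseteq> K"
    and max: "\<And>x t. homothet x t L \<subseteq> K \<Longrightarrow> t \<le> 1"
    and ab: "a \<ge> 0" "b \<ge> 0" "a + b = 1"
  shows "a * vol K + b * vol L \<le> vol (minkowski_comb a b K L)"
proof -
  have cK: "compact K" "convex K" "interior K \<noteq> {}" and cL: "compact L" "convex L"
    using K L by (auto simp: convex_body_def)
  define V where "V = {v \<in> sphere 0 1. support_fun K v = support_fun L v}"
  have contact: "\<exists>q\<in>K \<inter> L. \<forall>x\<in>K \<union> L. x \<bullet> v \<le> q \<bullet> v" if "v \<in> V" for v
  proof -
    obtain q where q: "q \<in> L" "support_fun L v = q \<bullet> v" by (rule support_fun_attained[OF L])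
    moreover have "x \<bullet> v \<le> q \<bullet> v" if "x \<in> K \<union> L" for x
      using that sub support_fun_le[OF K, of x v] \<open>v \<in> V\<close> q by (auto simp: V_def)
    ultimately show ?thesis using sub by blast
  qed
  have "0 \<in> convex hull V" unfolding V_def by (rule contact_directions[OF K L sub max])
  then consider (two) v where "v \<in> V" "- v \<in> V"
    | (three) u v w c1 c2 c3 where "\<not> (\<exists>v\<in>V. - v \<in> V)" "u \<in> V" "v \<in> V" "w \<in> V"
      "c1 > 0" "c2 > 0" "c3 > 0" "c1 *\<^sub>R u + c2 *\<^sub>R v + c3 *\<^sub>R w = 0"
  proof -
    have "V \<subseteq> sphere 0 1" by (auto simp: V_def)
    from zero_in_hull_plane[OF this \<open>0 \<in> convex hull V\<close>] show ?thesis using that by blast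
  qed
  then show ?thesis
  proof cases
    case two
    from contact[OF two(1)] obtain q1 where q1: "q1 \<in> K \<inter> L" "\<And>x. x \<in> K \<union> L \<Longrightarrow> x \<bullet> v \<le> q1 \<bullet> v" by blast
    from contact[OF two(2)] obtain q2 where q2: "q2 \<in> K \<inter> L" "\<And>x. x \<in> K \<union> L \<Longrightarrow> x \<bullet> (- v) \<le> q2 \<bullet> (- v)" by blast
    have "v \<noteq> 0" using two by (auto simp: V_def)
    then show ?thesis
      using q1 q2 by (intro area_comb_between_points[OF cK(1,2) cL q2(1) q1(1) _ _ ab]) auto
  next
    case three
    from contact[OF three(2)] obtain q1 where q1: "q1 \<in> K \<inter> L" "\<And>x. x \<in> K \<union> L \<Longrightarrow> x \<bullet> u \<le> q1 \<bullet> u" by blast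
    from contact[OF three(3)] obtain q2 where q2: "q2 \<in> K \<inter> L" "\<And>x. x \<in> K \<union> L \<Longrightarrow> x \<bullet> v \<le> q2 \<bullet> v" by blast
    from contact[OF three(4)] obtain q3 where q3: "q3 \<in> K \<inter> L" "\<And>x. x \<in> K \<union> L \<Longrightarrow> x \<bullet> w \<le> q3 \<bullet> w" by blast
    have n: "norm u = 1" "norm v = 1" "u \<noteq> - v" using three(1-3) by (auto simp: V_def)
    show ?thesis
      by (rule area_comb_three_contacts[OF cK cL q1(1) q2(1) q3(1) q1(2) q2(2) q3(2) three(5-8) n ab])
  qed
qed

section \<open>Power means of two numbers\<close>

text \<open>
  The three cases of the \<open>p\<close>-mean of two numbers; for \<open>p = -\<infinity>\<close> it is the minimum, so that
  the intersection of two bodies is described by support functions like the other means.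
\<close>

definition lp_mean :: "ereal \<Rightarrow> real \<Rightarrow> real \<Rightarrow> real" where
  "lp_mean p a b =
     (if p = -\<infinity> then min a b else if p = 0 then sqrt a * sqrt b
      else half_power_mean (real_of_ereal p) a b)"

lemma ereal_nonpos_cases:
  assumes "p \<le> (0::ereal)"
  obtains (inf) "p = -\<infinity>" | (zero) "p = 0" | (neg) s where "p = ereal s" "s < 0"
  using assms by (cases p) force+

lemma lp_mean_commute: "lp_mean p a b = lp_mean p b a"
  by (auto simp: lp_mean_def half_power_mean_def add.commute mult.commute min.commute)

lemma lp_mean_zero: "lp_mean p 0 0 = 0"
  by (simp add: lp_mean_def half_power_mean_def)

lemma lp_mean_scale:
  assumes p: "p \<le> 0" and c: "c \<ge> 0"
  shows "lp_mean p (c * a) (c * b) = c * lp_mean p a b"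
proof (cases "c = 0")
  case True
  then show ?thesis by (simp add: lp_mean_zero)
next
  case False
  with c have c: "c > 0" by simp
  show ?thesis
    using p
  proof (cases rule: ereal_nonpos_cases)
    case inf
    then show ?thesis using c by (simp add: lp_mean_def min_mult_distrib_left)
  next
    case zero
    then show ?thesis using c by (simp add: lp_mean_def real_sqrt_mult)
  next
    case (neg s)
    have "((c * a) powr s + (c * b) powr s) / 2 = c powr s * ((a powr s + b powr s) / 2)"
      by (simp add: powr_mult algebra_simps)
    moreover have "(c powr s) powr (1 / s) = c" using c neg by (simp add: powr_powr)
    ultimately have "(((c * a) powr s + (c * b) powr s) / 2) powr (1 / s)
        = c * ((a powr s + b powr s) / 2) powr (1 / s)"
      by (simp only: powr_mult)
    then show ?thesis using neg c by (simp add: lp_mean_def half_power_mean_def)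
  qed
qed

lemma lp_mean_pos:
  assumes "p \<le> 0" "a > 0" "b > 0" shows "lp_mean p a b > 0"
  using assms(1)
proof (cases rule: ereal_nonpos_cases)
  case (neg s)
  have "a powr s + b powr s > 0" using assms by (simp add: add_pos_pos)
  then have "((a powr s + b powr s) / 2) powr (1 / s) > 0" by simp
  then show ?thesis using neg assms by (simp add: lp_mean_def half_power_mean_def)
qed (use assms in \<open>auto simp: lp_mean_def\<close>)

lemma scalar_factor_eq:
  assumes "p \<le> 0" "t > 0" shows "scalar_factor p t = (lp_mean p t 1)\<^sup>2"
  using assms(1)
proof (cases rule: ereal_nonpos_cases)
  case (neg s)
  have "1 + t powr s > 0" by (simp add: add_pos_nonneg)
  then have "((1 + t powr s) / 2) powr (2 / s) = (((1 + t powr s) / 2) powr (1 / s))\<^sup>2"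
    by (subst powr_power) auto
  then show ?thesis
    using neg assms by (simp add: scalar_factor_def lp_mean_def half_power_mean_def add.commute)
qed (use assms in \<open>auto simp: scalar_factor_def lp_mean_def\<close>)

lemma lp_mean_mono:
  assumes p: "p \<le> 0" and t: "0 < s" "s \<le> t"
  shows "lp_mean p s 1 \<le> lp_mean p t 1"
  using p
proof (cases rule: ereal_nonpos_cases)
  case (neg q)
  have "t powr q \<le> s powr q" using neg t by (intro powr_mono2') auto
  moreover have "(t powr q + 1) / 2 > 0" by (simp add: add_nonneg_pos)
  ultimately have "((s powr q + 1) / 2) powr (1 / q) \<le> ((t powr q + 1) / 2) powr (1 / q)"
    using neg by (intro powr_mono2') auto
  then show ?thesis using neg t by (simp add: lp_mean_def half_power_mean_def)
qed (use t in \<open>auto simp: lp_mean_def\<close>)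

text \<open>
  For \<open>p < 0\<close>, the derivative at \<open>t\<close> is \<open>((1 + t\<^sup>-\<^sup>p) / 2)\<close> to the negative power \<open>1 / p - 1\<close>,
  divided by 2, and hence decreasing.
\<close>

lemma concave_on_lp_mean:
  assumes p: "p \<le> 0"
  shows "concave_on {0<..} (\<lambda>t. lp_mean p t 1)"
  using p
proof (cases rule: ereal_nonpos_cases)
  case inf
  have "u * min x 1 + v * min y 1 \<le> min (u * x + v * y) 1"
    if "u \<ge> 0" "v \<ge> 0" "u + v = 1" for u v x y :: real
  proof -
    have "u * min x 1 + v * min y 1 \<le> u * x + v * y" "u * min x 1 + v * min y 1 \<le> u * 1 + v * 1"
      using that by (intro add_mono mult_left_mono; simp)+
    with that show ?thesis by simp
  qed
  then show ?thesis using inf by (simp add: lp_mean_def concave_on_iff)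
next
  case zero
  have "convex_on {0<..} (\<lambda>t. - sqrt t)"
  proof (rule convex_on_realI[where f' = "\<lambda>t. - (inverse (sqrt t) / 2)"])
    fix x :: real assume "x \<in> {0<..}"
    then show "((\<lambda>t. - sqrt t) has_real_derivative - (inverse (sqrt x) / 2)) (at x)"
      by (auto intro!: derivative_eq_intros)
  qed (auto simp: le_imp_inverse_le)
  then show ?thesis using zero by (simp add: lp_mean_def concave_on_def)
next
  case (neg s)
  define f where "f t = ((t powr s + 1) / 2) powr (1 / s)" for t :: real
  define f' where "f' t = ((1 + t powr (- s)) / 2) powr (1 / s - 1) / 2" for t :: real
  have "convex_on {0<..} (\<lambda>t. - f t)"
  proof (rule convex_on_realI[where f' = "\<lambda>t. - f' t"])
    fix x :: real assume "x \<in> {0<..}"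
    then have x: "x > 0" by simp
    have g: "((\<lambda>t. (t powr s + 1) / 2) has_real_derivative s * x powr (s - 1) / 2) (at x)"
      using x by (auto intro!: derivative_eq_intros)
    have pos: "(x powr s + 1) / 2 > 0" by (simp add: add_nonneg_pos)
    have "(f has_real_derivative
        (1 / s * ((x powr s + 1) / 2) powr (1 / s - 1)) * (s * x powr (s - 1) / 2)) (at x)"
      unfolding f_def by (rule DERIV_chain2[OF has_real_derivative_powr[OF pos] g])
    moreover have "(1 / s * ((x powr s + 1) / 2) powr (1 / s - 1)) * (s * x powr (s - 1) / 2) = f' x"
    proof -
      have "x powr (s - 1) = (x powr (- s)) powr (1 / s - 1)"
        using neg x by (simp add: powr_powr algebra_simps)
      moreover have "x powr (- s) * ((x powr s + 1) / 2) = (1 + x powr (- s)) / 2"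
        using x by (simp add: distrib_left powr_add[symmetric])
      ultimately have "x powr (s - 1) * ((x powr s + 1) / 2) powr (1 / s - 1)
          = ((1 + x powr (- s)) / 2) powr (1 / s - 1)"
        by (simp only: powr_mult[symmetric])
      then show ?thesis using neg by (simp add: f'_def mult.commute)
    qed
    ultimately show "((\<lambda>t. - f t) has_real_derivative - f' x) (at x)"
      by (simp add: DERIV_minus)
  next
    fix x y :: real assume xy: "x \<in> {0<..}" "y \<in> {0<..}" "x \<le> y"
    have "x powr (- s) \<le> y powr (- s)" using xy neg by (intro powr_mono2) auto
    moreover have "(1 + x powr (- s)) / 2 > 0" by (simp add: add_pos_nonneg)
    moreover have "1 / s - 1 \<le> 0" using neg by (simp add: field_simps)
    ultimately have "((1 + y powr (- s)) / 2) powr (1 / s - 1) \<le> ((1 + x powr (- s)) / 2) powr (1 / s - 1)"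
      by (intro powr_mono2') auto
    then show "- f' x \<le> - f' y" by (simp add: f'_def)
  qed simp
  then have "concave_on {0<..} f" by (simp add: concave_on_def)
  moreover have "lp_mean p t 1 = f t" for t
    using neg by (simp add: lp_mean_def half_power_mean_def f_def)
  ultimately show ?thesis by simp
qed

lemma lp_mean_chord:
  assumes p: "p \<le> 0" and r: "0 < r" "r \<le> R"
  obtains \<alpha> \<beta> where "\<alpha> \<ge> 0" "\<beta> \<ge> 0" "\<alpha> * r + \<beta> = lp_mean p r 1" "\<alpha> * R + \<beta> = lp_mean p R 1"
    "\<And>t. r \<le> t \<Longrightarrow> t \<le> R \<Longrightarrow> \<alpha> * t + \<beta> \<le> lp_mean p t 1"
proof (cases "r = R")
  case True
  have "lp_mean p r 1 > 0" using p r by (intro lp_mean_pos) auto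
  then show thesis using that[of 0 "lp_mean p r 1"] True by (simp add: order.order_iff_strict)
next
  case False
  with r have lt: "r < R" by simp
  let ?m = "\<lambda>t. lp_mean p t 1"
  define \<alpha> where "\<alpha> = (?m R - ?m r) / (R - r)"
  define \<beta> where "\<beta> = (?m r * R - ?m R * r) / (R - r)"
  \<comment> \<open>Homogeneity turns the monotonicity of \<open>m\<close> into that of \<open>m(t) / t\<close>, which makes \<open>\<beta>\<close> nonnegative.\<close>
  have inv: "?m t = t * ?m (1 / t)" if "t > 0" for t
    using lp_mean_scale[OF p, of t 1 "1 / t"] that lp_mean_commute by simp
  have "?m (1 / R) \<le> ?m (1 / r)" using lt r by (intro lp_mean_mono[OF p]) (auto simp: field_simps)
  then have "r * R * ?m (1 / R) \<le> r * R * ?m (1 / r)" using r lt by simp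
  then have "?m R * r \<le> ?m r * R" using inv[of r] inv[of R] r lt by (simp add: mult_ac)
  then have \<beta>: "\<beta> \<ge> 0" using lt by (simp add: \<beta>_def)
  have \<alpha>: "\<alpha> \<ge> 0" using lp_mean_mono[OF p r] lt by (simp add: \<alpha>_def)
  have lin: "\<alpha> * t + \<beta> = ((R - t) * ?m r + (t - r) * ?m R) / (R - r)" for t
  proof -
    have "\<alpha> * t + \<beta> = ((?m R - ?m r) * t + (?m r * R - ?m R * r)) / (R - r)"
      by (simp add: \<alpha>_def \<beta>_def add_divide_distrib)
    also have "(?m R - ?m r) * t + (?m r * R - ?m R * r) = (R - t) * ?m r + (t - r) * ?m R"
      by (simp add: algebra_simps)
    finally show ?thesis .
  qed
  show thesis
  proof (rule that[OF \<alpha> \<beta>])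
    show "\<alpha> * r + \<beta> = ?m r" "\<alpha> * R + \<beta> = ?m R" unfolding lin using lt by simp_all
    fix t assume t: "r \<le> t" "t \<le> R"
    define u where "u = (t - r) / (R - r)"
    have u: "0 \<le> u" "u \<le> 1" "1 - u = (R - t) / (R - r)"
      using t lt by (auto simp: u_def field_simps)
    have "(1 - u) * r + u * R = r + u * (R - r)" by (simp add: algebra_simps)
    also have "\<dots> = t" using lt by (simp add: u_def)
    finally have eq: "(1 - u) * r + u * R = t" .
    have "(1 - u) * ?m r + u * ?m R \<le> ?m ((1 - u) *\<^sub>R r + u *\<^sub>R R)"
      using concave_onD[OF concave_on_lp_mean[OF p] u(1,2)] r lt by simp
    then show "\<alpha> * t + \<beta> \<le> ?m t"
      unfolding lin using eq by (simp add: u(3)) (simp add: u_def add_divide_distrib)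
  qed
qed

section \<open>The lower bound for the area of the mean body\<close>

lemma lp_mean_ratio:
  assumes "p \<le> 0" "b \<ge> 0" shows "lp_mean p (t * b) b = b * lp_mean p t 1"
  using lp_mean_scale[OF assms, of t 1] by (simp add: mult.commute)

lemma vol_homothet:
  fixes K :: "(real^2) set"
  shows "vol ((\<lambda>y. t *\<^sub>R y) ` K) = t\<^sup>2 * vol K"
  using measure_lebesgue_affine[of t 0 K] by simp

lemma convex_body_scaleR:
  assumes "convex_body K" "t \<noteq> 0" shows "convex_body ((\<lambda>y. t *\<^sub>R y) ` K)"
proof -
  have "interior ((\<lambda>y. t *\<^sub>R y) ` K) = (\<lambda>y. t *\<^sub>R y) ` interior K"
    using assms(2) by (intro interior_injective_linear_image) (auto simp: inj_on_def linear_scaleR)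
  then show ?thesis
    using assms(1) by (auto simp: convex_body_def compact_scaling convex_scaling)
qed

lemma vol_convex_body_pos:
  fixes K :: "'a::euclidean_space set"
  assumes "convex_body K" shows "vol K > 0"
proof -
  have K: "K \<in> lmeasurable" using assms by (simp add: convex_body_def lmeasurable_compact)
  have "\<not> negligible (interior K)"
    using assms by (intro open_not_negligible) (auto simp: convex_body_def)
  then have "\<not> negligible K" using interior_subset negligible_subset by blast
  then have "vol K \<noteq> 0" using K by (simp add: negligible_iff_measure0)
  then show ?thesis by (simp add: zero_less_measure_iff)
qed

lemma minkowski_comb_commute: "minkowski_comb a b K L = minkowski_comb b a L K"
proof -
  have "minkowski_comb a b K L \<subseteq> minkowski_comb b a L K" for a b and K L :: "'a set"
  proof
    fix z assume "z \<in> minkowski_comb a b K L"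
    then obtain x y where "x \<in> K" "y \<in> L" "z = b *\<^sub>R y + a *\<^sub>R x"
      unfolding minkowski_comb_def by (auto simp: add.commute)
    then show "z \<in> minkowski_comb b a L K" by (simp add: minkowski_combI)
  qed
  then show ?thesis by blast
qed

text \<open>The inequality for maximal homothetic copies, applied to \<open>K\<close> and \<open>r L\<close> and rescaled.\<close>

lemma area_comb_inradius:
  fixes K L :: "(real^2) set"
  assumes K: "convex_body K" and L: "convex_body L" and r: "r > 0" "(\<lambda>y. r *\<^sub>R y) ` L \<subseteq> K"
    and max: "\<And>x t. t > 0 \<Longrightarrow> homothet x t L \<subseteq> K \<Longrightarrow> t \<le> r"
    and \<alpha>: "\<alpha> \<ge> 0" "\<beta> \<ge> 0"
  shows "(\<alpha> * r + \<beta>) * (\<alpha> * (vol K / r) + \<beta> * vol L) \<le> vol (minkowski_comb \<alpha> \<beta> K L)"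
proof (cases "\<alpha> * r + \<beta> = 0")
  case True
  then show ?thesis by simp
next
  case False
  define m where "m = \<alpha> * r + \<beta>"
  have "\<alpha> * r \<ge> 0" using \<alpha> r by simp
  then have m: "m > 0" using False \<alpha> by (simp add: m_def)
  define a where "a = \<alpha> * r / m"
  define b where "b = \<beta> / m"
  have ab: "a \<ge> 0" "b \<ge> 0" "a + b = 1"
    using \<alpha> r m by (auto simp: a_def b_def m_def add_divide_distrib[symmetric])
  let ?L = "(\<lambda>y. r *\<^sub>R y) ` L"
  have "a * vol K + b * vol ?L \<le> vol (minkowski_comb a b K ?L)"
  proof (rule area_comb_maximal_homothet[OF K _ r(2) _ ab])
    show "convex_body ?L" using L r by (intro convex_body_scaleR) auto
    fix x t assume h: "homothet x t ?L \<subseteq> K"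
    show "t \<le> 1"
    proof (cases "t > 0")
      case True
      have "homothet x (t * r) L \<subseteq> K" using h by (simp add: image_image)
      then have "t * r \<le> r" using max True r by simp
      then show ?thesis using r by simp
    qed simp
  qed
  then have le: "a * vol K + b * (r\<^sup>2 * vol L) \<le> vol (minkowski_comb a b K ?L)"
    by (simp add: vol_homothet)
  have "minkowski_comb \<alpha> \<beta> K L = (\<lambda>y. (m / r) *\<^sub>R y) ` minkowski_comb a b K ?L"
  proof -
    have "\<alpha> = m / r * a" "\<beta> = m / r * b * r" using m r by (simp_all add: a_def b_def)
    then have eq: "\<alpha> *\<^sub>R x + \<beta> *\<^sub>R y = (m / r) *\<^sub>R (a *\<^sub>R x + b *\<^sub>R (r *\<^sub>R y))" for x y :: "real^2"
      by (simp add: scaleR_add_right)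
    show ?thesis unfolding minkowski_comb_def eq by blast
  qed
  then have "vol (minkowski_comb \<alpha> \<beta> K L) = (m / r)\<^sup>2 * vol (minkowski_comb a b K ?L)"
    by (simp add: vol_homothet)
  also have "\<dots> \<ge> (m / r)\<^sup>2 * (a * vol K + b * (r\<^sup>2 * vol L))"
    using le by (intro mult_left_mono) auto
  also have "(m / r)\<^sup>2 * (a * vol K + b * (r\<^sup>2 * vol L)) = m * (\<alpha> * (vol K / r) + \<beta> * vol L)"
    using m r by (simp add: a_def b_def power2_eq_square field_simps)
  finally show ?thesis by (simp add: m_def)
qed

context
  fixes K L :: "(real^2) set" and r R :: real
  assumes K: "convex_body K" and L: "convex_body L" and dil: "dilation_position K L"
  defines r: "r \<equiv> rel_inradius K L" and R: "R \<equiv> rel_outradius K L"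
begin

lemma inradius_pos: "r > 0"
  using rel_inradius_max(1)[OF K L] by (simp add: r)

lemma outradius_pos: "R > 0"
  using rel_outradius_min(1)[OF K L] by (simp add: R)

lemma zero_mem: "0 \<in> K" "0 \<in> L"
  using dil by (auto simp: dilation_position_def)

lemma support_fun_nonneg: "support_fun K v \<ge> 0" "support_fun L v \<ge> 0"
  using support_fun_le[OF K zero_mem(1), of v] support_fun_le[OF L zero_mem(2), of v] by simp_all

lemma inradius_support_fun: "r * support_fun L v \<le> support_fun K v"
proof -
  obtain y where y: "y \<in> L" "support_fun L v = y \<bullet> v" by (rule support_fun_attained[OF L])
  then have "r *\<^sub>R y \<in> K" using dil by (auto simp: dilation_position_def r)
  from support_fun_le[OF K this, of v] y(2) show ?thesis by simp
qed

lemma outradius_support_fun: "support_fun K v \<le> R * support_fun L v"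
proof -
  obtain x where x: "x \<in> K" "support_fun K v = x \<bullet> v" by (rule support_fun_attained[OF K])
  then obtain y where y: "y \<in> L" "x = R *\<^sub>R y" using dil by (auto simp: dilation_position_def R)
  then show ?thesis using x support_fun_le[OF L y(1), of v] outradius_pos by simp
qed

lemma inradius_le_outradius: "r \<le> R"
proof -
  have "r\<^sup>2 * vol L \<le> R\<^sup>2 * vol L"
  proof -
    have "(\<lambda>y. r *\<^sub>R y) ` L \<subseteq> (\<lambda>y. R *\<^sub>R y) ` L"
      using dil by (auto simp: dilation_position_def r R)
    moreover have "compact ((\<lambda>y. t *\<^sub>R y) ` L)" for t
      using L by (simp add: convex_body_def compact_scaling)
    ultimately have "vol ((\<lambda>y. r *\<^sub>R y) ` L) \<le> vol ((\<lambda>y. R *\<^sub>R y) ` L)"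
      by (intro measure_mono_fmeasurable fmeasurableD lmeasurable_compact)
    then show ?thesis by (simp add: vol_homothet)
  qed
  then have "r\<^sup>2 \<le> R\<^sup>2" using vol_convex_body_pos[OF L] by simp
  then show ?thesis using outradius_pos by (rule power2_le_imp_le[OF _ less_imp_le])
qed

lemma support_fun_ratio:
  obtains (zero) "support_fun K v = 0" "support_fun L v = 0"
  | (pos) t where "support_fun L v > 0" "support_fun K v = t * support_fun L v" "r \<le> t" "t \<le> R"
proof (cases "support_fun L v = 0")
  case True
  then show thesis
    using zero outradius_support_fun[of v] support_fun_nonneg(1)[of v] by simp
next
  case False
  then have p: "support_fun L v > 0" using support_fun_nonneg(2)[of v] by simp
  then show thesis
    using pos[of "support_fun K v / support_fun L v"] inradius_support_fun[of v] outradius_support_fun[of v]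
    by (simp add: field_simps)
qed

lemma lp_mean_support_fun_ge:
  assumes p: "p \<le> 0" and ab: "\<And>t. r \<le> t \<Longrightarrow> t \<le> R \<Longrightarrow> \<alpha> * t + \<beta> \<le> lp_mean p t 1"
  shows "\<alpha> * support_fun K v + \<beta> * support_fun L v
      \<le> lp_mean p (support_fun K v) (support_fun L v)"
proof (cases rule: support_fun_ratio[of v])
  case zero
  then show ?thesis by (simp add: lp_mean_zero)
next
  case (pos t)
  have "support_fun L v * (\<alpha> * t + \<beta>) \<le> support_fun L v * lp_mean p t 1"
    using pos ab by simp
  then show ?thesis using pos lp_mean_ratio[OF p, of "support_fun L v" t] by (simp add: algebra_simps)
qed

lemma lp_mean_support_fun_le:
  assumes p: "p \<le> 0"
  shows "lp_mean p (support_fun K v) (support_fun L v) \<le> lp_mean p R 1 * support_fun L v"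
proof (cases rule: support_fun_ratio[of v])
  case zero
  then show ?thesis by (simp add: lp_mean_zero)
next
  case (pos t)
  have "lp_mean p t 1 \<le> lp_mean p R 1" using pos inradius_pos by (intro lp_mean_mono[OF p]) auto
  then show ?thesis using pos lp_mean_ratio[OF p, of "support_fun L v" t] by simp
qed

lemma Lp_mean_eq:
  assumes p: "p \<le> 0"
  shows "Lp_mean p K L
    = {x. \<forall>v\<in>sphere 0 1. x \<bullet> v \<le> lp_mean p (support_fun K v) (support_fun L v)}"
proof (cases "p = -\<infinity>")
  case True
  then show ?thesis
    using mem_iff_support_fun[OF K] mem_iff_support_fun[OF L]
    by (auto simp: Lp_mean_def lp_mean_def)
next
  case False
  then show ?thesis by (simp add: Lp_mean_def lp_mean_def)
qed

lemma compact_Lp_mean: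
  assumes p: "p \<le> 0" shows "compact (Lp_mean p K L)"
proof -
  let ?m = "lp_mean p R 1"
  have m: "?m > 0" using p outradius_pos by (intro lp_mean_pos) auto
  have "Lp_mean p K L \<subseteq> (\<lambda>y. ?m *\<^sub>R y) ` L"
  proof
    fix x assume "x \<in> Lp_mean p K L"
    then have "x \<bullet> v \<le> ?m * support_fun L v" if "v \<in> sphere 0 1" for v
      using that lp_mean_support_fun_le[OF p, of v] unfolding Lp_mean_eq[OF p] by force
    then have "inverse ?m *\<^sub>R x \<in> L"
      unfolding mem_iff_support_fun[OF L] using m by (simp add: field_simps)
    then show "x \<in> (\<lambda>y. ?m *\<^sub>R y) ` L"
      using m by (intro image_eqI[where x = "inverse ?m *\<^sub>R x"]) auto
  qed
  moreover have "compact ((\<lambda>y. ?m *\<^sub>R y) ` L)"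
    using L by (simp add: convex_body_def compact_scaling)
  ultimately have "bounded (Lp_mean p K L)"
    using bounded_subset compact_imp_bounded by blast
  moreover have "closed (Lp_mean p K L)"
  proof -
    have "Lp_mean p K L = (\<Inter>v\<in>sphere 0 1. {x. x \<bullet> v \<le> lp_mean p (support_fun K v) (support_fun L v)})"
      unfolding Lp_mean_eq[OF p] by auto
    also have "closed \<dots>"
      by (intro closed_INT ballI closed_Collect_le continuous_intros)
    finally show ?thesis .
  qed
  ultimately show ?thesis by (simp add: compact_eq_bounded_closed)
qed

text \<open>
  Below a linear minorant of the scalar mean, the mean body contains a Minkowski
  combination. The second estimate exchanges the roles of \<open>K\<close> and \<open>L\<close>: the inradius of \<open>L\<close> with
  respect to \<open>K\<close> is \<open>1 / R\<close>.
\<close>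

lemma area_Lp_mean_ge:
  assumes p: "p \<le> 0" and \<alpha>: "\<alpha> \<ge> 0" "\<beta> \<ge> 0"
    and ab: "\<And>t. r \<le> t \<Longrightarrow> t \<le> R \<Longrightarrow> \<alpha> * t + \<beta> \<le> lp_mean p t 1"
  shows "(\<alpha> * r + \<beta>) * (\<alpha> * (vol K / r) + \<beta> * vol L) \<le> vol (Lp_mean p K L)"
    and "(\<alpha> * R + \<beta>) * (\<alpha> * (vol K / R) + \<beta> * vol L) \<le> vol (Lp_mean p K L)"
proof -
  have sub: "minkowski_comb \<alpha> \<beta> K L \<subseteq> Lp_mean p K L"
  proof
    fix z assume "z \<in> minkowski_comb \<alpha> \<beta> K L"
    then obtain x y where xy: "x \<in> K" "y \<in> L" "z = \<alpha> *\<^sub>R x + \<beta> *\<^sub>R y"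
      unfolding minkowski_comb_def by blast
    have "z \<bullet> v \<le> lp_mean p (support_fun K v) (support_fun L v)" for v
    proof -
      have "z \<bullet> v \<le> \<alpha> * support_fun K v + \<beta> * support_fun L v"
        unfolding xy(3) inner_add_left inner_scaleR_left
        using \<alpha> support_fun_le[OF K xy(1), of v] support_fun_le[OF L xy(2), of v]
        by (intro add_mono mult_left_mono)
      also have "\<dots> \<le> lp_mean p (support_fun K v) (support_fun L v)"
        by (rule lp_mean_support_fun_ge[OF p ab])
      finally show ?thesis .
    qed
    then show "z \<in> Lp_mean p K L" unfolding Lp_mean_eq[OF p] by blast
  qed
  have cK: "compact K" "compact L" using K L by (auto simp: convex_body_def)
  have le: "vol (minkowski_comb \<alpha> \<beta> K L) \<le> vol (Lp_mean p K L)"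
    using sub by (intro measure_mono_fmeasurable fmeasurableD lmeasurable_compact
        compact_minkowski_comb compact_Lp_mean p cK)
  have "(\<alpha> * r + \<beta>) * (\<alpha> * (vol K / r) + \<beta> * vol L) \<le> vol (minkowski_comb \<alpha> \<beta> K L)"
  proof (rule area_comb_inradius[OF K L inradius_pos _ _ \<alpha>])
    show "(\<lambda>y. r *\<^sub>R y) ` L \<subseteq> K" using dil by (simp add: dilation_position_def r)
    show "t \<le> r" if "t > 0" "homothet x t L \<subseteq> K" for x t
      using that rel_inradius_max(2)[OF K L] unfolding r by blast
  qed
  with le show "(\<alpha> * r + \<beta>) * (\<alpha> * (vol K / r) + \<beta> * vol L) \<le> vol (Lp_mean p K L)" by linarith
  have "(\<beta> * (1 / R) + \<alpha>) * (\<beta> * (vol L / (1 / R)) + \<alpha> * vol K) \<le> vol (minkowski_comb \<beta> \<alpha> L K)"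
  proof (rule area_comb_inradius[OF L K _ _ _ \<alpha>(2,1)])
    show "1 / R > 0" using outradius_pos by simp
    show "(\<lambda>y. (1 / R) *\<^sub>R y) ` K \<subseteq> L"
    proof
      fix z assume "z \<in> (\<lambda>y. (1 / R) *\<^sub>R y) ` K"
      then obtain y where "y \<in> L" "z = (1 / R) *\<^sub>R (R *\<^sub>R y)"
        using dil by (auto simp: dilation_position_def R)
      then show "z \<in> L" using outradius_pos by simp
    qed
    fix x t assume t: "t > 0" "homothet x t K \<subseteq> L"
    have "K \<subseteq> homothet (- (1 / t) *\<^sub>R x) (1 / t) L"
    proof
      fix k assume "k \<in> K"
      then have "x + t *\<^sub>R k \<in> L" using t by blast
      moreover have "k = - (1 / t) *\<^sub>R x + (1 / t) *\<^sub>R (x + t *\<^sub>R k)"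
        using t by (simp add: scaleR_add_right)
      ultimately show "k \<in> homothet (- (1 / t) *\<^sub>R x) (1 / t) L" by blast
    qed
    then have "\<exists>x. K \<subseteq> homothet x (1 / t) L" by (rule exI)
    then have "1 / t \<in> {t. 0 < t \<and> (\<exists>x. K \<subseteq> homothet x t L)}" using t by simp
    then have "R \<le> 1 / t" using rel_outradius_min(2)[OF K L] unfolding R by blast
    then show "t \<le> 1 / R" using t outradius_pos by (simp add: field_simps)
  qed
  moreover have "(\<beta> * (1 / R) + \<alpha>) * (\<beta> * (vol L / (1 / R)) + \<alpha> * vol K)
      = (\<alpha> * R + \<beta>) * (\<alpha> * (vol K / R) + \<beta> * vol L)"
  proof -
    have "\<beta> * (1 / R) + \<alpha> = (\<alpha> * R + \<beta>) / R"
      using outradius_pos by (simp add: field_simps)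
    moreover have "\<beta> * (vol L / (1 / R)) + \<alpha> * vol K = R * (\<alpha> * (vol K / R) + \<beta> * vol L)"
      using outradius_pos by (simp add: field_simps)
    ultimately show ?thesis using outradius_pos by (simp only:) simp
  qed
  ultimately show "(\<alpha> * R + \<beta>) * (\<alpha> * (vol K / R) + \<beta> * vol L) \<le> vol (Lp_mean p K L)"
    using le minkowski_comb_commute[of \<alpha> \<beta> K L] by simp
qed

lemma area_bounds: "r\<^sup>2 * vol L \<le> vol K" "vol K \<le> R\<^sup>2 * vol L"
proof -
  have c: "compact K" "compact ((\<lambda>y. t *\<^sub>R y) ` L)" for t
    using K L by (auto simp: convex_body_def compact_scaling)
  have "vol ((\<lambda>y. r *\<^sub>R y) ` L) \<le> vol K"
    using dil c by (intro measure_mono_fmeasurable fmeasurableD lmeasurable_compact)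
      (auto simp: dilation_position_def r)
  then show "r\<^sup>2 * vol L \<le> vol K" by (simp add: vol_homothet)
  have "vol K \<le> vol ((\<lambda>y. R *\<^sub>R y) ` L)"
    using dil c by (intro measure_mono_fmeasurable fmeasurableD lmeasurable_compact)
      (auto simp: dilation_position_def R)
  then show "vol K \<le> R\<^sup>2 * vol L" by (simp add: vol_homothet)
qed

lemma planar_lower_bound_eq:
  assumes "p \<le> 0"
  shows "planar_lower_bound p \<mu> K L
    = min ((lp_mean p r 1)\<^sup>2 * ((vol K / r + \<mu> * vol L) / (r + \<mu>)))
          ((lp_mean p R 1)\<^sup>2 * ((vol K / R + \<mu> * vol L) / (R + \<mu>)))"
  using assms inradius_pos outradius_pos
  by (simp add: planar_lower_bound_def scalar_factor_eq r R)

theorem area_Lp_mean_ge_planar_lower_bound: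
  assumes p: "p \<le> 0" and \<mu>: "\<mu> > 0"
  shows "planar_lower_bound p \<mu> K L \<le> vol (Lp_mean p K L)"
proof -
  define X where "X = vol K"
  define Y where "Y = vol L"
  note pos = inradius_pos outradius_pos
  obtain \<alpha> \<beta> where \<alpha>: "\<alpha> \<ge> 0" "\<beta> \<ge> 0" and m: "\<alpha> * r + \<beta> = lp_mean p r 1" "\<alpha> * R + \<beta> = lp_mean p R 1"
    and ab: "\<And>t. r \<le> t \<Longrightarrow> t \<le> R \<Longrightarrow> \<alpha> * t + \<beta> \<le> lp_mean p t 1"
    using lp_mean_chord[OF p inradius_pos inradius_le_outradius] by metis
  note ge = area_Lp_mean_ge[OF p \<alpha> ab, folded X_def Y_def]
  \<comment> \<open>Replacing \<open>\<beta> / \<alpha>\<close> by \<open>\<mu>\<close> lowers the bound for \<open>t\<close> if \<open>\<alpha> \<mu> - \<beta>\<close> and \<open>X / t - t Y\<close> have the same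
    sign. The latter is nonnegative for \<open>t = r\<close> and nonpositive for \<open>t = R\<close>.\<close>
  have key: "(\<alpha> * t + \<beta>)\<^sup>2 * ((X / t + \<mu> * Y) / (t + \<mu>)) \<le> (\<alpha> * t + \<beta>) * (\<alpha> * (X / t) + \<beta> * Y)"
    if t: "t > 0" and s: "0 \<le> (\<alpha> * \<mu> - \<beta>) * (X / t - t * Y)" for t
  proof -
    have "(\<alpha> * u + \<beta> * Y) * (t + \<mu>) - (\<alpha> * t + \<beta>) * (u + \<mu> * Y)
        = (\<alpha> * \<mu> - \<beta>) * (u - t * Y)" for u
      by (simp add: algebra_simps)
    from this[of "X / t"] have "0 \<le> (\<alpha> * (X / t) + \<beta> * Y) * (t + \<mu>) - (\<alpha> * t + \<beta>) * (X / t + \<mu> * Y)"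
      using s by (simp only:)
    then have "(\<alpha> * t + \<beta>) * (X / t + \<mu> * Y) \<le> (\<alpha> * (X / t) + \<beta> * Y) * (t + \<mu>)"
      by (simp only: diff_ge_0_iff_ge)
    then have "(\<alpha> * t + \<beta>) * ((X / t + \<mu> * Y) / (t + \<mu>)) \<le> \<alpha> * (X / t) + \<beta> * Y"
      using t \<mu> by (simp add: pos_divide_le_eq)
    then have "(\<alpha> * t + \<beta>) * ((\<alpha> * t + \<beta>) * ((X / t + \<mu> * Y) / (t + \<mu>)))
        \<le> (\<alpha> * t + \<beta>) * (\<alpha> * (X / t) + \<beta> * Y)"
      using \<alpha> t by (intro mult_left_mono) auto
    then show ?thesis by (simp add: power2_eq_square mult.assoc)
  qed
  have "r * Y \<le> X / r" "X / R \<le> R * Y"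
    using area_bounds pos by (simp_all add: X_def Y_def field_simps power2_eq_square)
  then have "0 \<le> (\<alpha> * \<mu> - \<beta>) * (X / r - r * Y) \<or> 0 \<le> (\<alpha> * \<mu> - \<beta>) * (X / R - R * Y)"
    by (cases "\<alpha> * \<mu> \<ge> \<beta>") (simp_all add: mult_nonpos_nonpos)
  then show ?thesis
    using key[OF pos(1)] key[OF pos(2)] ge
    unfolding planar_lower_bound_eq[OF p] X_def[symmetric] Y_def[symmetric] m[symmetric]
    by (auto simp: min_le_iff_disj)
qed
end

section \<open>Cases of equality\<close>

lemma support_fun_zero: "convex_body K \<Longrightarrow> support_fun K 0 = 0"
  using support_fun_scaleR[of K 0 0] by simp

context
  fixes K L :: "(real^2) set"
  assumes K: "convex_body K" and L: "convex_body L" and dil: "dilation_position K L"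
begin

lemma area_Lp_mean_equal_radii:
  assumes p: "p \<le> 0" and \<mu>: "\<mu> > 0" and eq: "rel_inradius K L = rel_outradius K L"
  shows "vol (Lp_mean p K L) = planar_lower_bound p \<mu> K L"
proof -
  define r where "r = rel_inradius K L"
  have r: "r > 0" unfolding r_def by (rule inradius_pos[OF K L dil])
  define m where "m = lp_mean p r 1"
  have m: "m > 0" using lp_mean_pos[OF p r] by (simp add: m_def)
  have h: "support_fun K v = r * support_fun L v" for v
    using inradius_support_fun[OF K L dil, of v] outradius_support_fun[OF K L dil, of v] eq
    by (simp add: r_def)
  have bound: "lp_mean p (support_fun K v) (support_fun L v) = m * support_fun L v" for v
    using lp_mean_ratio[OF p support_fun_nonneg(2)[OF K L dil], of r v] by (simp add: h m_def)
  have "Lp_mean p K L = (\<lambda>y. m *\<^sub>R y) ` L"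
  proof (intro set_eqI)
    fix x
    have "x \<in> Lp_mean p K L \<longleftrightarrow> inverse m *\<^sub>R x \<in> L"
      unfolding Lp_mean_eq[OF K L dil p] mem_iff_support_fun[OF L] bound using m by (simp add: field_simps)
    also have "\<dots> \<longleftrightarrow> x \<in> (\<lambda>y. m *\<^sub>R y) ` L"
    proof
      assume "inverse m *\<^sub>R x \<in> L"
      then show "x \<in> (\<lambda>y. m *\<^sub>R y) ` L" using m by (intro image_eqI[where x = "inverse m *\<^sub>R x"]) auto
    qed (use m in auto)
    finally show "x \<in> Lp_mean p K L \<longleftrightarrow> x \<in> (\<lambda>y. m *\<^sub>R y) ` L" .
  qed
  then have "vol (Lp_mean p K L) = m\<^sup>2 * vol L" by (simp add: vol_homothet)
  moreover have "vol K = r\<^sup>2 * vol L"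
    using area_bounds[OF K L dil] eq by (simp add: r_def)
  then have "(vol K / r + \<mu> * vol L) / (r + \<mu>) = vol L"
    using r \<mu> by (simp add: power2_eq_square field_simps)
  then have "planar_lower_bound p \<mu> K L = m\<^sup>2 * vol L"
    unfolding planar_lower_bound_eq[OF K L dil p] eq[symmetric] r_def[symmetric] m_def[symmetric] by simp
  ultimately show ?thesis by simp
qed

text \<open>By homogeneity, the defining inequalities hold for normals of any length.\<close>

lemma inner_le_of_mem_Lp_mean:
  assumes p: "p \<le> 0" and x: "x \<in> Lp_mean p K L"
  shows "x \<bullet> v \<le> lp_mean p (support_fun K v) (support_fun L v)"
proof (cases "v = 0")
  case True
  then show ?thesis by (simp add: support_fun_zero K L lp_mean_zero)
next
  case False
  define u where "u = inverse (norm v) *\<^sub>R v"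
  have v: "v = norm v *\<^sub>R u" using False by (simp add: u_def)
  have "u \<in> sphere 0 1" using False by (simp add: u_def)
  then have "x \<bullet> u \<le> lp_mean p (support_fun K u) (support_fun L u)"
    using x unfolding Lp_mean_eq[OF K L dil p] by blast
  then have "norm v * (x \<bullet> u) \<le> norm v * lp_mean p (support_fun K u) (support_fun L u)"
    by (intro mult_left_mono) auto
  also have "\<dots> = lp_mean p (support_fun K (norm v *\<^sub>R u)) (support_fun L (norm v *\<^sub>R u))"
    by (simp add: support_fun_scaleR K L lp_mean_scale[OF p])
  also have "norm v * (x \<bullet> u) = x \<bullet> (norm v *\<^sub>R u)" by simp
  finally show ?thesis using v by simp
qed

end

lemma measure_linear_image_cbox:
  fixes T :: "real^2 \<Rightarrow> real^2"
  assumes T: "linear T" and le: "c $ 1 \<le> d $ 1" "c $ 2 \<le> d $ 2"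
  shows "vol (T ` cbox c d) = \<bar>det (matrix T)\<bar> * ((d $ 1 - c $ 1) * (d $ 2 - c $ 2))"
proof -
  have "vol (T ` cbox c d) = \<bar>det (matrix T)\<bar> * vol (cbox c d)"
    by (rule measure_linear_image[OF T]) simp
  moreover have "cbox c d \<noteq> {}" using le by (simp add: interval_ne_empty_cart forall_2)
  then have "vol (cbox c d) = (d $ 1 - c $ 1) * (d $ 2 - c $ 2)"
    by (simp add: content_cbox_cart UNIV_2)
  ultimately show ?thesis by simp
qed

text \<open>
  Two linear images of boxes such that the sides of the first are \<open>t i\<close> times the sides of
  the second, including their position relative to the origin. Only the four inequalities for
  the edge normals are used.
\<close>

lemma area_Lp_mean_boxes_le:
  fixes K L :: "(real^2) set" and T :: "real^2 \<Rightarrow> real^2" and t :: "2 \<Rightarrow> real"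
  assumes bodies: "convex_body K" "convex_body L" "dilation_position K L"
    and T: "linear T" "inj T" and KL: "K = T ` cbox a b" "L = T ` cbox c d"
    and t: "\<And>i. t i > 0" and hom: "\<And>i. a $ i = t i * c $ i" "\<And>i. b $ i = t i * d $ i"
    and p: "p \<le> 0"
  shows "vol (Lp_mean p K L) \<le> lp_mean p (t 1) 1 * lp_mean p (t 2) 1 * vol L"
proof -
  obtain g where g: "linear g" "\<And>x. g (T x) = x" "\<And>x. T (g x) = x"
    using linear_injective_isomorphism[OF T refl] by blast
  have "0 \<in> L" using zero_mem[OF bodies] by blast
  then obtain z where "z \<in> cbox c d" "T z = 0" using KL by force
  moreover have "T 0 = 0" using T(1) by (rule linear_0)
  ultimately have "0 \<in> cbox c d" using T(2) by (metis injD)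
  then have cd: "c $ i \<le> 0" "0 \<le> d $ i" for i by (simp_all add: mem_box_cart)
  have ab: "a $ i \<le> 0" "0 \<le> b $ i" for i
    using hom cd t[of i] by (simp_all add: mult_nonneg_nonpos)
  \<comment> \<open>\<open>n i\<close> is the normal that reads off the \<open>i\<close>-th coordinate of the preimage under \<open>T\<close>.\<close>
  define n where "n i = adjoint g (axis i 1)" for i
  have n: "T x \<bullet> n i = x $ i" for x i
    using adjoint_works[OF g(1), of "T x" "axis i 1"] by (simp add: n_def g(2) inner_axis inner_commute)
  have h: "support_fun M (n i) = q $ i \<and> support_fun M (- n i) = - l $ i"
    if M: "convex_body M" "M = T ` cbox l q" and le: "\<And>i. l $ i \<le> q $ i" for M l q i
  proof
    have mem: "T q \<in> M" "T l \<in> M" using M(2) le by (auto simp: mem_box_cart)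
    obtain x where "x \<in> M" "support_fun M (n i) = x \<bullet> n i" by (rule support_fun_attained[OF M(1)])
    then have "support_fun M (n i) \<le> q $ i" using M(2) n by (auto simp: mem_box_cart)
    then show "support_fun M (n i) = q $ i" using support_fun_le[OF M(1) mem(1), of "n i"] n by simp
    obtain x where "x \<in> M" "support_fun M (- n i) = x \<bullet> (- n i)" by (rule support_fun_attained[OF M(1)])
    then have "support_fun M (- n i) \<le> - l $ i" using M(2) n by (auto simp: mem_box_cart)
    then show "support_fun M (- n i) = - l $ i" using support_fun_le[OF M(1) mem(2), of "- n i"] n by simp
  qed
  have hK: "support_fun K (n i) = t i * d $ i" "support_fun K (- n i) = t i * (- c $ i)" for i
    using h[OF bodies(1) KL(1)] ab hom order_trans[OF ab] by auto
  have hL: "support_fun L (n i) = d $ i" "support_fun L (- n i) = - c $ i" for i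
    using h[OF bodies(2) KL(2)] order_trans[OF cd] by auto
  define m where "m i = lp_mean p (t i) 1" for i
  have m: "m i > 0" for i using lp_mean_pos[OF p t[of i], of 1] by (simp add: m_def)
  let ?c = "\<chi> i. m i * c $ i" and ?d = "\<chi> i. m i * d $ i"
  have "Lp_mean p K L \<subseteq> T ` cbox ?c ?d"
  proof
    fix x assume x: "x \<in> Lp_mean p K L"
    have "g x $ i \<le> m i * d $ i" "m i * c $ i \<le> g x $ i" for i
    proof -
      have "x \<bullet> n i = g x $ i" using n[of "g x" i] g(3) by simp
      then show "g x $ i \<le> m i * d $ i" "m i * c $ i \<le> g x $ i"
        using inner_le_of_mem_Lp_mean[OF bodies p x, of "n i"]
          inner_le_of_mem_Lp_mean[OF bodies p x, of "- n i"]
          lp_mean_ratio[OF p cd(2)[of i], of "t i"] lp_mean_ratio[OF p, of "- c $ i" "t i"] cd(1)[of i]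
        unfolding hK hL by (simp_all add: m_def mult.commute)
    qed
    then have "g x \<in> cbox ?c ?d" by (simp add: mem_box_cart)
    then show "x \<in> T ` cbox ?c ?d" using g(3) by (metis imageI)
  qed
  moreover have "T ` cbox ?c ?d \<in> lmeasurable"
    using T(1) by (intro measurable_linear_image) auto
  ultimately have "vol (Lp_mean p K L) \<le> vol (T ` cbox ?c ?d)"
    by (intro measure_mono_fmeasurable fmeasurableD[OF lmeasurable_compact] compact_Lp_mean bodies p)
  also have "\<dots> = m 1 * m 2 * vol L"
  proof -
    have "m i * c $ i \<le> m i * d $ i" for i
      using m[of i] order_trans[OF cd(1)[of i] cd(2)[of i]] by simp
    then show ?thesis
      unfolding KL(2) using order_trans[OF cd]
      by (subst (1 2) measure_linear_image_cbox[OF T(1)]) (auto simp: algebra_simps)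
  qed
  finally show ?thesis by (simp add: m_def)
qed

text \<open>
  For boxes the relative radii are the extreme ratios of side lengths. A side realising the
  inradius or the outradius leaves no room for a translation, so that the dilation position
  determines its position; in the plane, this applies to both sides.
\<close>

lemma radii_boxes:
  fixes K L :: "(real^2) set" and T :: "real^2 \<Rightarrow> real^2"
  assumes bodies: "convex_body K" "convex_body L" "dilation_position K L"
    and T: "linear T" "inj T" and KL: "K = T ` cbox a b" "L = T ` cbox c d"
    and lt: "\<And>i. a $ i < b $ i" "\<And>i. c $ i < d $ i"
  defines "t \<equiv> \<lambda>i. (b $ i - a $ i) / (d $ i - c $ i)"
  shows "rel_inradius K L = min (t 1) (t 2)" and "rel_outradius K L = max (t 1) (t 2)"
    and "a $ i = t i * c $ i" and "b $ i = t i * d $ i"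
proof -
  define r where "r = rel_inradius K L"
  define R where "R = rel_outradius K L"
  define m where "m = min (t 1) (t 2)"
  define M where "M = max (t 1) (t 2)"
  have r: "r > 0" unfolding r_def by (rule inradius_pos[OF bodies])
  have R: "R > 0" unfolding R_def by (rule outradius_pos[OF bodies])
  have tpos: "t i > 0" and tw: "t i * (d $ i - c $ i) = b $ i - a $ i" for i
    using lt[of i] by (simp_all add: t_def)
  have mt: "m \<le> t i" "t i \<le> M" for i
    using exhaust_2[of i] by (auto simp: m_def M_def)
  have mpos: "m > 0" "M > 0" using tpos[of 1] tpos[of 2] by (auto simp: m_def M_def)
  have lin: "T (x + s *\<^sub>R y) = T x + s *\<^sub>R T y" for x y s
    by (simp add: linear_add[OF T(1)] linear_scale[OF T(1)])
  have mem: "T x \<in> T ` S \<longleftrightarrow> x \<in> S" for x S using T(2) by (simp add: inj_image_mem_iff)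
  have in_r: "a $ i \<le> r * z $ i \<and> r * z $ i \<le> b $ i" if "z \<in> cbox c d" for z i
  proof -
    have "r *\<^sub>R T z \<in> K" using bodies(3) that KL by (auto simp: dilation_position_def r_def)
    then have "T (r *\<^sub>R z) \<in> T ` cbox a b" using KL by (simp add: linear_scale[OF T(1)])
    then show ?thesis unfolding mem by (simp add: mem_box_cart)
  qed
  have cd: "c \<in> cbox c d" "d \<in> cbox c d" "a \<in> cbox a b" "b \<in> cbox a b"
    using lt by (simp_all add: mem_box_cart less_imp_le)
  note rin = in_r[OF cd(1)] in_r[OF cd(2)]
  have in_R: "R * c $ i \<le> z $ i \<and> z $ i \<le> R * d $ i" if z: "z \<in> cbox a b" for z i
  proof -
    have "T z \<in> K" using z KL by blast
    then obtain y where y: "y \<in> cbox c d" "T z = R *\<^sub>R T y"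
      using bodies(3) KL by (auto simp: dilation_position_def R_def)
    then have "T z = T (R *\<^sub>R y)" by (simp add: linear_scale[OF T(1)])
    then have "z = R *\<^sub>R y" using T(2) by (simp add: inj_eq)
    then show ?thesis using y(1) R by (simp add: mem_box_cart)
  qed
  note Rin = in_R[OF cd(3)] in_R[OF cd(4)]
  have rt: "r \<le> t i" for i
  proof -
    have "r * (d $ i - c $ i) \<le> t i * (d $ i - c $ i)"
      using rin[of i] unfolding tw by (simp add: right_diff_distrib)
    then show ?thesis using lt(2)[of i] by simp
  qed
  have Rt: "t i \<le> R" for i
  proof -
    have "t i * (d $ i - c $ i) \<le> R * (d $ i - c $ i)"
      using Rin[of i] unfolding tw by (simp add: right_diff_distrib)
    then show ?thesis using lt(2)[of i] by simp
  qed
  have "homothet (T (a - m *\<^sub>R c)) m L \<subseteq> K"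
  proof
    fix x assume "x \<in> homothet (T (a - m *\<^sub>R c)) m L"
    then obtain z where z: "z \<in> cbox c d" "x = T ((a - m *\<^sub>R c) + m *\<^sub>R z)"
      unfolding KL(2) lin by blast
    have "0 \<le> m * (z $ i - c $ i) \<and> m * (z $ i - c $ i) \<le> b $ i - a $ i" for i
    proof -
      have zi: "c $ i \<le> z $ i" "z $ i \<le> d $ i" using z(1) by (simp_all add: mem_box_cart)
      then have "m * (z $ i - c $ i) \<le> t i * (d $ i - c $ i)"
        using mt[of i] mpos by (intro mult_mono) auto
      then show ?thesis using zi mpos unfolding tw by simp
    qed
    then have "(a - m *\<^sub>R c) + m *\<^sub>R z \<in> cbox a b"
      by (simp add: mem_box_cart right_diff_distrib)
        (metis add.commute add_diff_eq diff_add_cancel diff_ge_0_iff_ge le_diff_eq right_diff_distrib)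
    then show "x \<in> K" using z KL by blast
  qed
  then have "\<exists>x. homothet x m L \<subseteq> K" by (rule exI)
  then have "m \<le> r" using rel_inradius_max(2)[OF bodies(1,2)] mpos unfolding r_def by blast
  then have rm: "r = m" using rt[of 1] rt[of 2] by (simp add: m_def)
  have "K \<subseteq> homothet (T (a - M *\<^sub>R c)) M L"
  proof
    fix x assume "x \<in> K"
    then obtain z where z: "z \<in> cbox a b" "x = T z" using KL by blast
    define y where "y = c + (1 / M) *\<^sub>R (z - a)"
    have "c $ i \<le> y $ i \<and> y $ i \<le> d $ i" for i
    proof -
      have zi: "a $ i \<le> z $ i" "z $ i \<le> b $ i" using z(1) by (simp_all add: mem_box_cart)
      have "t i * (d $ i - c $ i) \<le> M * (d $ i - c $ i)"
        using mt[of i] lt(2)[of i] by (intro mult_right_mono) auto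
      then have "z $ i - a $ i \<le> M * (d $ i - c $ i)" using zi unfolding tw by linarith
      then have "(z $ i - a $ i) / M \<le> d $ i - c $ i" using mpos by (simp add: pos_divide_le_eq mult.commute)
      then show ?thesis using zi mpos by (simp add: y_def)
    qed
    then have "y \<in> cbox c d" by (simp add: mem_box_cart)
    moreover have "z = (a - M *\<^sub>R c) + M *\<^sub>R y" using mpos by (simp add: y_def scaleR_add_right)
    then have "x = T (a - M *\<^sub>R c) + M *\<^sub>R T y" unfolding z(2) by (simp only: lin)
    ultimately show "x \<in> homothet (T (a - M *\<^sub>R c)) M L" unfolding KL(2) by blast
  qed
  then have "\<exists>x. K \<subseteq> homothet x M L" by (rule exI)
  then have "R \<le> M" using rel_outradius_min(2)[OF bodies(1,2)] mpos unfolding R_def by blast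
  then have RM: "R = M" using Rt[of 1] Rt[of 2] by (simp add: M_def)
  show "rel_inradius K L = min (t 1) (t 2)" using rm by (simp add: r_def m_def)
  show "rel_outradius K L = max (t 1) (t 2)" using RM by (simp add: R_def M_def)
  have "t i = r \<or> t i = R"
    using exhaust_2[of i] unfolding rm RM by (auto simp: m_def M_def min_def max_def)
  then have "a $ i = t i * c $ i \<and> b $ i = t i * d $ i"
    using tw[of i] rin[of i] Rin[of i] by (auto simp: right_diff_distrib)
  then show "a $ i = t i * c $ i" "b $ i = t i * d $ i" by auto
qed

text \<open>
  The scalars may be negative; this changes only the corner of the parallelogram from which
  the edge vectors emanate.
\<close>

lemma parallelogram_eq_image:
  fixes u w :: "real^2" and T :: "real^2 \<Rightarrow> real^2"
  assumes P: "parallelogram_with_sides P (\<alpha> *\<^sub>R u) (\<beta> *\<^sub>R w)"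
    and T: "T = (\<lambda>z. z $ 1 *\<^sub>R u + z $ 2 *\<^sub>R w)" "surj T"
  obtains c d where "P = T ` cbox c d" "\<And>i. c $ i < d $ i"
proof -
  have "independent {\<alpha> *\<^sub>R u, \<beta> *\<^sub>R w}" using P by (simp add: parallelogram_with_sides_def)
  then have nz: "\<alpha> \<noteq> 0" "\<beta> \<noteq> 0" by (auto simp: dependent_zero)
  obtain x where x: "P = {x + s *\<^sub>R (\<alpha> *\<^sub>R u) + t *\<^sub>R (\<beta> *\<^sub>R w) | s t. s \<in> {0..1} \<and> t \<in> {0..1}}"
    using P by (auto simp: parallelogram_with_sides_def)
  obtain k where k: "x = T k" using T(2) by (meson surjD)
  define c :: "real^2" where "c = vector [k $ 1 + min \<alpha> 0, k $ 2 + min \<beta> 0]"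
  define d :: "real^2" where "d = vector [k $ 1 + max \<alpha> 0, k $ 2 + max \<beta> 0]"
  have unit: "(\<exists>s\<in>{0..1}. y = k + s * \<gamma>) \<longleftrightarrow> k + min \<gamma> 0 \<le> y \<and> y \<le> k + max \<gamma> 0"
    if "\<gamma> \<noteq> 0" for k y \<gamma> :: real
  proof
    assume "\<exists>s\<in>{0..1}. y = k + s * \<gamma>"
    then obtain s where s: "0 \<le> s" "s \<le> 1" "y = k + s * \<gamma>" by auto
    show "k + min \<gamma> 0 \<le> y \<and> y \<le> k + max \<gamma> 0"
    proof (cases "\<gamma> \<ge> 0")
      case True
      then show ?thesis using s mult_right_mono[of s 1 \<gamma>] by simp
    next
      case False
      then show ?thesis using s mult_right_mono_neg[of s 1 \<gamma>] by (simp add: mult_nonneg_nonpos)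
    qed
  next
    assume "k + min \<gamma> 0 \<le> y \<and> y \<le> k + max \<gamma> 0"
    then have "(y - k) / \<gamma> \<in> {0..1}"
      using that by (cases "\<gamma> > 0") (auto simp: field_simps)
    moreover have "y = k + (y - k) / \<gamma> * \<gamma>" using that by simp
    ultimately show "\<exists>s\<in>{0..1}. y = k + s * \<gamma>" by blast
  qed
  have "P = T ` cbox c d"
  proof (intro set_eqI iffI)
    fix y assume "y \<in> P"
    then obtain s t where st: "s \<in> {0..1}" "t \<in> {0..1}" "y = x + s *\<^sub>R (\<alpha> *\<^sub>R u) + t *\<^sub>R (\<beta> *\<^sub>R w)"
      using x by blast
    then have "y = T (vector [k $ 1 + s * \<alpha>, k $ 2 + t * \<beta>])"
      by (simp add: k T(1) algebra_simps)
    moreover have "vector [k $ 1 + s * \<alpha>, k $ 2 + t * \<beta>] \<in> cbox c d"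
      using unit[OF nz(1), of "k $ 1 + s * \<alpha>" "k $ 1"] unit[OF nz(2), of "k $ 2 + t * \<beta>" "k $ 2"] st
      unfolding mem_box_cart forall_2 c_def d_def by auto
    ultimately show "y \<in> T ` cbox c d" by blast
  next
    fix y assume "y \<in> T ` cbox c d"
    then obtain z where z: "z \<in> cbox c d" "y = T z" by blast
    obtain s where s: "s \<in> {0..1}" "z $ 1 = k $ 1 + s * \<alpha>"
      using unit[OF nz(1), of "z $ 1" "k $ 1"] z(1) unfolding mem_box_cart forall_2 c_def d_def by auto
    obtain t where t: "t \<in> {0..1}" "z $ 2 = k $ 2 + t * \<beta>"
      using unit[OF nz(2), of "z $ 2" "k $ 2"] z(1) unfolding mem_box_cart forall_2 c_def d_def by auto
    have "y = x + s *\<^sub>R (\<alpha> *\<^sub>R u) + t *\<^sub>R (\<beta> *\<^sub>R w)"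
      by (simp add: z(2) k T(1) s(2) t(2) algebra_simps)
    then show "y \<in> P" using x s(1) t(1) by blast
  qed
  moreover have "c $ i < d $ i" for i
    using exhaust_2[of i] nz by (auto simp: c_def d_def)
  ultimately show thesis using that by blast
qed

lemma parallel_parallelograms_boxes:
  fixes K L :: "(real^2) set"
  assumes "parallel_parallelograms K L"
  shows "\<exists>(T :: real^2 \<Rightarrow> real^2) a b c d. linear T \<and> inj T \<and> K = T ` cbox a b \<and> L = T ` cbox c d \<and>
    (\<forall>i. a $ i < b $ i) \<and> (\<forall>i. c $ i < d $ i)"
proof -
  obtain u w u' w' where P: "parallelogram_with_sides K u w" "parallelogram_with_sides L u' w'"
    and span: "u' \<in> span {u}" "w' \<in> span {w}"
    using assms by (auto simp: parallel_parallelograms_def)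
  obtain \<alpha> \<beta> where \<alpha>: "u' = \<alpha> *\<^sub>R u" "w' = \<beta> *\<^sub>R w" using span by (auto simp: span_singleton)
  define T :: "real^2 \<Rightarrow> real^2" where "T = (\<lambda>z. z $ 1 *\<^sub>R u + z $ 2 *\<^sub>R w)"
  have lin: "linear T" by (rule linearI) (simp_all add: T_def algebra_simps)
  have uw: "independent {u, w}" "u \<noteq> w" using P(1) by (auto simp: parallelogram_with_sides_def)
  then have "u \<notin> span {w}" by (simp add: independent_insert)
  moreover have "w \<noteq> 0" using uw(1) by (auto simp: dependent_zero)
  ultimately have "z = 0" if "T z = 0" for z
  proof -
    have "z $ 1 = 0"
    proof (rule ccontr)
      assume z1: "z $ 1 \<noteq> 0"
      have "z $ 1 *\<^sub>R u = (- z $ 2) *\<^sub>R w" using that by (simp add: T_def eq_neg_iff_add_eq_0)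
      then have "inverse (z $ 1) *\<^sub>R (z $ 1 *\<^sub>R u) = inverse (z $ 1) *\<^sub>R ((- z $ 2) *\<^sub>R w)" by simp
      then have "u = (inverse (z $ 1) * (- z $ 2)) *\<^sub>R w" using z1 by simp
      then have "u \<in> span {w}" unfolding span_singleton by blast
      with \<open>u \<notin> span {w}\<close> show False by simp
    qed
    moreover from this have "z $ 2 = 0" using that \<open>w \<noteq> 0\<close> by (simp add: T_def)
    ultimately show ?thesis by (simp add: vec_eq_iff forall_2)
  qed
  then have inj: "inj T" using lin by (simp add: linear_injective_0)
  then have surj: "surj T" using lin by (intro linear_injective_imp_surjective) auto
  have "parallelogram_with_sides K (1 *\<^sub>R u) (1 *\<^sub>R w)" using P(1) by simp
  from parallelogram_eq_image[OF this T_def surj]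
  obtain a b where 1: "K = T ` cbox a b" "\<And>i. a $ i < b $ i" by blast
  from parallelogram_eq_image[OF P(2)[unfolded \<alpha>] T_def surj]
  obtain c d where 2: "L = T ` cbox c d" "\<And>i. c $ i < d $ i" by blast
  show ?thesis using lin inj 1 2 by blast
qed

text \<open>
  Equal areas force \<open>t 1 * t 2 = 1\<close>, hence \<open>r R = 1\<close>, and both terms of the lower bound coincide
  with the upper bound \<open>m(t 1) m(t 2) |L|\<close>.
\<close>

lemma area_Lp_mean_parallelograms:
  fixes K L :: "(real^2) set"
  assumes bodies: "convex_body K" "convex_body L" "dilation_position K L"
    and par: "parallel_parallelograms K L" and vol: "vol K = vol L" and p: "p \<le> 0"
  shows "vol (Lp_mean p K L) = planar_lower_bound p 1 K L"
proof (rule antisym)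
  show "planar_lower_bound p 1 K L \<le> vol (Lp_mean p K L)"
    by (rule area_Lp_mean_ge_planar_lower_bound[OF bodies p]) simp
  obtain T :: "real^2 \<Rightarrow> real^2" and a b c d where T: "linear T" "inj T" and KL: "K = T ` cbox a b" "L = T ` cbox c d"
    and lt: "\<And>i::2. a $ i < b $ i" "\<And>i::2. c $ i < (d $ i :: real)"
    using parallel_parallelograms_boxes[OF par] by blast
  define t where "t i = (b $ i - a $ i) / (d $ i - c $ i)" for i
  note radii = radii_boxes[OF bodies T KL lt, folded t_def]
  have t: "t i > 0" for i using lt[of i] by (simp add: t_def)
  define m where "m s = lp_mean p s 1" for s
  define Y where "Y = vol L"
  have le: "vol (Lp_mean p K L) \<le> m (t 1) * m (t 2) * Y"
    using area_Lp_mean_boxes_le[OF bodies T KL t radii(3,4) p] by (simp add: m_def Y_def)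
  have "t 1 * t 2 = 1"
  proof -
    have "\<bar>det (matrix T)\<bar> * ((b $ 1 - a $ 1) * (b $ 2 - a $ 2))
        = \<bar>det (matrix T)\<bar> * ((d $ 1 - c $ 1) * (d $ 2 - c $ 2))"
      using vol lt unfolding KL by (simp add: measure_linear_image_cbox[OF T(1)] less_imp_le)
    moreover have "\<bar>det (matrix T)\<bar> \<noteq> 0"
      using vol_convex_body_pos[OF bodies(1)] lt unfolding KL
      by (auto simp: measure_linear_image_cbox[OF T(1)] less_imp_le)
    ultimately have "(b $ 1 - a $ 1) * (b $ 2 - a $ 2) = (d $ 1 - c $ 1) * (d $ 2 - c $ 2)"
      using mult_left_cancel by blast
    then show ?thesis using lt(2)[of 1] lt(2)[of 2] by (simp add: t_def)
  qed
  then have inv: "t 1 = 1 / t 2" "t 2 = 1 / t 1" using t[of 1] t[of 2] by (auto simp: field_simps)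
  have flip: "m (1 / s) = m s / s" if "s > 0" for s
    using lp_mean_scale[OF p, of "1 / s" 1 s] that lp_mean_commute[of p 1 s] by (simp add: m_def)
  have prod1: "m (t 1) * m (t 2) = (m (t 1))\<^sup>2 / t 1"
    using flip[OF t[of 1], folded inv(2)] by (simp add: power2_eq_square)
  have prod2: "m (t 1) * m (t 2) = (m (t 2))\<^sup>2 / t 2"
    using flip[OF t[of 2], folded inv(1)] by (simp add: power2_eq_square)
  have term1: "(m s)\<^sup>2 * ((Y / s + 1 * Y) / (s + 1)) = (m s)\<^sup>2 / s * Y" if "s > 0" for s
  proof -
    have "Y / s + 1 * Y = Y / s * (s + 1)" using that by (simp add: distrib_left)
    then show ?thesis using that by simp
  qed
  have "{rel_inradius K L, rel_outradius K L} = {t 1, t 2}"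
    unfolding radii by (auto simp: min_def max_def)
  then have "planar_lower_bound p 1 K L = Min ((\<lambda>s. (m s)\<^sup>2 * ((Y / s + 1 * Y) / (s + 1))) ` {t 1, t 2})"
    using t scalar_factor_eq[OF p] unfolding planar_lower_bound_def vol by (simp add: m_def Y_def)
  also have "\<dots> = m (t 1) * m (t 2) * Y"
    using term1[OF t[of 1], folded prod1] term1[OF t[of 2], folded prod2]
    by (simp only: image_insert image_empty) simp
  finally show "vol (Lp_mean p K L) \<le> planar_lower_bound p 1 K L" using le by simp
qed

lemma dilates_equal_radii:
  fixes K L :: "(real^2) set"
  assumes bodies: "convex_body K" "convex_body L" "dilation_position K L" and dil: "dilates K L"
  shows "rel_inradius K L = rel_outradius K L"
proof (rule antisym)
  show "rel_inradius K L \<le> rel_outradius K L" by (rule inradius_le_outradius[OF bodies])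
  obtain c where c: "c > 0" "K = homothet 0 c L" using dil by (auto simp: dilates_def)
  then have "c \<le> rel_inradius K L" "rel_outradius K L \<le> c"
    using rel_inradius_max(2)[OF bodies(1,2)] rel_outradius_min(2)[OF bodies(1,2)] by blast+
  then show "rel_outradius K L \<le> rel_inradius K L" by simp
qed

section \<open>The logarithmic mean, the intersection, and the main result\<close>

lemma planar_lower_bound_zero:
  fixes K L :: "(real^2) set"
  assumes bodies: "convex_body K" "convex_body L" "dilation_position K L"
  defines "\<mu> \<equiv> sqrt (vol K / vol L)"
  shows "0 < \<mu>" and "planar_lower_bound 0 \<mu> K L = sqrt (vol K) * sqrt (vol L)"
proof -
  have pos: "vol K > 0" "vol L > 0" using bodies vol_convex_body_pos by auto
  then show \<mu>: "0 < \<mu>" by (simp add: \<mu>_def)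
  have X: "vol K = \<mu> * \<mu> * vol L" using pos by (simp add: \<mu>_def)
  have "scalar_factor 0 t * ((vol K / t + \<mu> * vol L) / (t + \<mu>)) = \<mu> * vol L" if "t > 0" for t
  proof -
    have "t * (vol K / t + \<mu> * vol L) = \<mu> * vol L * (t + \<mu>)"
      using that by (simp add: X algebra_simps)
    then show ?thesis using that \<mu> by (simp add: scalar_factor_def)
  qed
  moreover have "\<mu> * vol L = sqrt (vol K) * sqrt (vol L)"
  proof -
    have "u / v * (v * v) = u * v" if "v \<noteq> 0" for u v :: real
      using that by simp
    from this[of "sqrt (vol L)" "sqrt (vol K)"]
    have "sqrt (vol K) / sqrt (vol L) * vol L = sqrt (vol K) * sqrt (vol L)"
      using pos by simp
    then show ?thesis by (simp only: \<mu>_def real_sqrt_divide)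
  qed
  ultimately show "planar_lower_bound 0 \<mu> K L = sqrt (vol K) * sqrt (vol L)"
    using inradius_pos[OF bodies] outradius_pos[OF bodies] by (simp add: planar_lower_bound_def)
qed

lemma planar_lower_bound_minus_infinity:
  fixes K L :: "(real^2) set"
  assumes bodies: "convex_body K" "convex_body L" "dilation_position K L"
  defines "r \<equiv> rel_inradius K L" and "R \<equiv> rel_outradius K L"
  assumes r1: "r < 1" and R1: "1 < R"
  defines "\<mu> \<equiv> r * (R - 1) / (1 - r)"
  shows "0 < \<mu>" and "min (vol K / R) (r * vol L) \<le> planar_lower_bound (-\<infinity>) \<mu> K L"
proof -
  have r: "r > 0" unfolding r_def by (rule inradius_pos[OF bodies])
  then show \<mu>: "0 < \<mu>" using r1 R1 by (simp add: \<mu>_def)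
  define X where "X = vol K"
  define Y where "Y = vol L"
  define m where "m = min (X / R) (r * Y)"
  have pos: "X > 0" "Y > 0" using bodies vol_convex_body_pos by (auto simp: X_def Y_def)
  have m: "m \<le> X / R" "m \<le> r * Y" "m > 0" using pos r R1 by (auto simp: m_def)
  have \<mu>e: "(1 - r) * \<mu> = r * (R - 1)" using r1 by (simp add: \<mu>_def)
  have ge: "m * (t + \<mu>) \<le> s * (X / t + \<mu> * Y)"
    if "(1 - r) * (m * (t + \<mu>)) \<le> (1 - r) * (s * (X / t + \<mu> * Y))" for s t
    using that r1 by simp
  have "m * (R + \<mu>) \<le> 1 * (X / R + \<mu> * Y)"
  proof (rule ge)
    have "(1 - r) * (m * (R + \<mu>)) = (1 - r) * m * R + m * ((1 - r) * \<mu>)" by (simp add: algebra_simps)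
    also have "\<dots> = (1 - r) * m + (R - 1) * m" unfolding \<mu>e by (simp add: algebra_simps)
    also have "\<dots> \<le> (1 - r) * (X / R) + (R - 1) * (r * Y)"
      using m r1 R1 by (intro add_mono mult_left_mono) auto
    also have "\<dots> = (1 - r) * (X / R) + ((1 - r) * \<mu>) * Y" unfolding \<mu>e by (simp add: algebra_simps)
    also have "\<dots> = (1 - r) * (1 * (X / R + \<mu> * Y))" by (simp add: algebra_simps)
    finally show "(1 - r) * (m * (R + \<mu>)) \<le> (1 - r) * (1 * (X / R + \<mu> * Y))" .
  qed
  moreover have "m * (r + \<mu>) \<le> r\<^sup>2 * (X / r + \<mu> * Y)"
  proof (rule ge)
    have RX: "R * m \<le> X" using m R1 by (simp add: field_simps)
    have "(1 - r) * (m * (r + \<mu>)) = (1 - r) * m * r + m * ((1 - r) * \<mu>)" by (simp add: algebra_simps)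
    also have "\<dots> = r * ((1 - r) * (R * m) + r * (R - 1) * m)"
      unfolding \<mu>e by (simp add: algebra_simps)
    also have "\<dots> \<le> r * ((1 - r) * X + r * (R - 1) * (r * Y))"
      using m r1 R1 r RX by (intro add_mono mult_left_mono) auto
    also have "\<dots> = r * ((1 - r) * X) + r\<^sup>2 * (((1 - r) * \<mu>) * Y)"
      unfolding \<mu>e by (simp add: algebra_simps power2_eq_square)
    also have "\<dots> = (1 - r) * (r\<^sup>2 * (X / r + \<mu> * Y))"
      using r by (simp add: algebra_simps power2_eq_square)
    finally show "(1 - r) * (m * (r + \<mu>)) \<le> (1 - r) * (r\<^sup>2 * (X / r + \<mu> * Y))" .
  qed
  ultimately have "m \<le> 1 * ((X / R + \<mu> * Y) / (R + \<mu>))" "m \<le> r\<^sup>2 * ((X / r + \<mu> * Y) / (r + \<mu>))"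
    using r R1 \<mu> by (simp_all add: pos_le_divide_eq)
  then show "min (vol K / R) (r * vol L) \<le> planar_lower_bound (-\<infinity>) \<mu> K L"
    using r1 R1 unfolding planar_lower_bound_def r_def[symmetric] R_def[symmetric] X_def[symmetric]
      Y_def[symmetric] m_def[symmetric]
    by (simp add: scalar_factor_def)
qed

theorem theorem1p1:
  fixes K L :: "(real^2) set" and r R :: real
  assumes "convex_body K" and "convex_body L"
    and "dilation_position K L"
    and "r = rel_inradius K L" and "R = rel_outradius K L"
  shows
    "(\<forall>p::ereal. \<forall>\<mu>::real. p \<le> 0 \<longrightarrow> 0 < \<mu> \<longrightarrow>
        vol (Lp_mean p K L) \<ge> planar_lower_bound p \<mu> K L)
   \<and> (dilates K L \<longrightarrow>
        (\<forall>p::ereal. \<forall>\<mu>::real. p \<le> 0 \<longrightarrow> 0 < \<mu> \<longrightarrow>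
           vol (Lp_mean p K L) = planar_lower_bound p \<mu> K L))
   \<and> (vol K = vol L \<longrightarrow> dilates K L \<or> parallel_parallelograms K L \<longrightarrow>
        (\<forall>p::ereal. p \<le> 0 \<longrightarrow>
           vol (Lp_mean p K L) = planar_lower_bound p 1 K L))
   \<and> (let \<mu> = sqrt (vol K / vol L) in
        0 < \<mu> \<and>
        planar_lower_bound 0 \<mu> K L \<ge> sqrt (vol K) * sqrt (vol L) \<and>
        vol (Lp_mean 0 K L) \<ge> sqrt (vol K) * sqrt (vol L))
   \<and> (r < 1 \<and> 1 < R \<longrightarrow>
        (let \<mu> = r * (R - 1) / (1 - r) in
          0 < \<mu> \<and>
          planar_lower_bound (-\<infinity>) \<mu> K L \<ge> min (vol K / R) (r * vol L) \<and>
          vol (K \<inter> L) \<ge> min (vol K / R) (r * vol L)))"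
proof -
  note bodies = assms(1-3)
  show ?thesis
  proof (intro conjI impI allI)
    fix p :: ereal and \<mu> :: real
    assume "p \<le> 0" "0 < \<mu>"
    then show "planar_lower_bound p \<mu> K L \<le> vol (Lp_mean p K L)"
      by (rule area_Lp_mean_ge_planar_lower_bound[OF bodies])
  next
    fix p :: ereal and \<mu> :: real
    assume "dilates K L" "p \<le> 0" "0 < \<mu>"
    then show "vol (Lp_mean p K L) = planar_lower_bound p \<mu> K L"
      by (intro area_Lp_mean_equal_radii[OF bodies] dilates_equal_radii[OF bodies])
  next
    fix p :: ereal
    assume "vol K = vol L" "dilates K L \<or> parallel_parallelograms K L" "p \<le> 0"
    then show "vol (Lp_mean p K L) = planar_lower_bound p 1 K L"
      using area_Lp_mean_parallelograms[OF bodies]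
        area_Lp_mean_equal_radii[OF bodies _ _ dilates_equal_radii[OF bodies]] by auto
  next
    show "let \<mu> = sqrt (vol K / vol L) in
        0 < \<mu> \<and>
        planar_lower_bound 0 \<mu> K L \<ge> sqrt (vol K) * sqrt (vol L) \<and>
        vol (Lp_mean 0 K L) \<ge> sqrt (vol K) * sqrt (vol L)"
      using planar_lower_bound_zero[OF bodies]
        area_Lp_mean_ge_planar_lower_bound[OF bodies _ planar_lower_bound_zero(1)[OF bodies], of 0]
      by (simp add: Let_def)
  next
    assume rR: "r < 1 \<and> 1 < R"
    define \<mu> where "\<mu> = r * (R - 1) / (1 - r)"
    have "0 < \<mu>" "min (vol K / R) (r * vol L) \<le> planar_lower_bound (-\<infinity>) \<mu> K L"
      using planar_lower_bound_minus_infinity[OF bodies] rR unfolding assms(4,5) \<mu>_def by auto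
    moreover from this have "planar_lower_bound (-\<infinity>) \<mu> K L \<le> vol (K \<inter> L)"
      using area_Lp_mean_ge_planar_lower_bound[OF bodies, of "-\<infinity>" \<mu>] by (simp add: Lp_mean_def)
    ultimately show "let \<mu> = r * (R - 1) / (1 - r) in
          0 < \<mu> \<and>
          planar_lower_bound (-\<infinity>) \<mu> K L \<ge> min (vol K / R) (r * vol L) \<and>
          vol (K \<inter> L) \<ge> min (vol K / R) (r * vol L)"
      unfolding \<mu>_def[symmetric] Let_def by linarith
  qed
qed

end
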